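(* Let $\mathbb{F}$ be a field, $G$ a finite group and $0\le m\le n$ with $n\geq 1$. The algebra homomorphism $\Phi:\mathbb{F}\overline{G}_n\to\mathbb{F}G_n$ maps $\overline{\mathcal{Z}}_{m,n}$ onto $\mathcal{Z}_{m,n}$.
   Context: $\overline{G}_n$ is the semigroup of $n\times n$ matrices with entries in $G\cup\{0\}$ having at most one nonzero entry in each row and column, under matrix multiplication with $g0=0g=0$, $g+0=0+g=g$ (0 an extra symbol). $G_n\subseteq\overline{G}_n$ is the subgroup of matrices with exactly one nonzero entry in each row and column (the wreath product of $G$ with $S_n$). $\mathbb{F}\overline{G}_n$ is the semigroup algebra with basis $\overline{G}_n$ (the zero matrix is one of the basis elements). $\varepsilon_j$ is the diagonal matrix with $(j,j)$ entry $0$ and other diagonal entries $1$; $\overline{G}_n$ is generated by $G_n$ and the $\varepsilon_j$. $\Phi$ is the algebra homomorphism that is the identity on $\mathbb{F}G_n$ and sends each $\varepsilon_j$ ($1\le j\le n$) to $0$. $\overline{G}'_{n-m}\subseteq\overline{G}_n$ is the subsemigroup of matrices whose first $m$ diagonal entries equal $1$, and $G'_{n-m}=G_n\cap\overline{G}'_{n-m}$. $\overline{\mathcal{Z}}_{m,n}$ is the centralizer of $\overline{G}'_{n-m}$ in $\mathbb{F}\overline{G}_n$, and $\mathcal{Z}_{m,n}$ is the centralizer of $G'_{n-m}$ in $\mathbb{F}G_n$. *)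

theory Defs
  imports "HOL-Algebra.Algebra"
begin

section \<open>Matrices over a group with an extra zero\<close>

text \<open>
  An element of \<open>G \<union> {0}\<close> is a value of type \<open>'g option\<close>, the extra symbol \<open>0\<close> being \<open>None\<close>.
  An \<open>n \<times> n\<close> matrix is a function of two indices in \<open>{1..n}\<close> that is \<open>None\<close> at all other indices.
\<close>

type_synonym 'g zmat = "nat \<Rightarrow> nat \<Rightarrow> 'g option"

fun zero_mult :: "('g, 'x) monoid_scheme \<Rightarrow> 'g option \<Rightarrow> 'g option \<Rightarrow> 'g option" where
  "zero_mult G (Some g) (Some h) = Some (g \<otimes>\<^bsub>G\<^esub> h)"
| "zero_mult G None y = None"
| "zero_mult G (Some g) None = None"

text \<open>
  The sum of two group elements has no meaning in \<open>G \<union> {0}\<close>; it never occurs in the product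
  of two matrices having at most one nonzero entry in each row and column.
\<close>

fun zero_add :: "'g option \<Rightarrow> 'g option \<Rightarrow> 'g option" where
  "zero_add None y = y"
| "zero_add (Some g) None = Some g"
| "zero_add (Some g) (Some h) = undefined"

definition zmat_mult :: "('g, 'x) monoid_scheme \<Rightarrow> nat \<Rightarrow> 'g zmat \<Rightarrow> 'g zmat \<Rightarrow> 'g zmat" where
  "zmat_mult G n A B =
     (\<lambda>i j. foldr (\<lambda>k s. zero_add (zero_mult G (A i k) (B k j)) s) [1..<Suc n] None)"

definition zmat_one :: "('g, 'x) monoid_scheme \<Rightarrow> nat \<Rightarrow> 'g zmat" where
  "zmat_one G n = (\<lambda>i j. if i = j \<and> i \<in> {1..n} then Some \<one>\<^bsub>G\<^esub> else None)"

definition zmats :: "('g, 'x) monoid_scheme \<Rightarrow> nat \<Rightarrow> 'g zmat set" where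
  "zmats G n = {A. \<forall>i j g. A i j = Some g \<longrightarrow> i \<in> {1..n} \<and> j \<in> {1..n} \<and> g \<in> carrier G}"

definition partial_monomial :: "('g, 'x) monoid_scheme \<Rightarrow> nat \<Rightarrow> 'g zmat monoid" where
  "partial_monomial G n =
     \<lparr>carrier = {A \<in> zmats G n. (\<forall>i\<in>{1..n}. \<exists>\<^sub>\<le>\<^sub>1 j. A i j \<noteq> None) \<and>
                                (\<forall>j\<in>{1..n}. \<exists>\<^sub>\<le>\<^sub>1 i. A i j \<noteq> None)},
      monoid.mult = zmat_mult G n,
      one = zmat_one G n\<rparr>"

definition monomial_group :: "('g, 'x) monoid_scheme \<Rightarrow> nat \<Rightarrow> 'g zmat monoid" where
  "monomial_group G n =
     \<lparr>carrier = {A \<in> zmats G n. (\<forall>i\<in>{1..n}. \<exists>!j. A i j \<noteq> None) \<and>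
                                (\<forall>j\<in>{1..n}. \<exists>!i. A i j \<noteq> None)},
      monoid.mult = zmat_mult G n,
      one = zmat_one G n\<rparr>"

definition zmat_eps :: "('g, 'x) monoid_scheme \<Rightarrow> nat \<Rightarrow> nat \<Rightarrow> 'g zmat" where
  "zmat_eps G n j = (\<lambda>i k. if i = k \<and> i \<in> {1..n} \<and> i \<noteq> j then Some \<one>\<^bsub>G\<^esub> else None)"

text \<open>
  The subsemigroups written with index \<open>n - m\<close> in the mathematical notation, i.e. those whose
  elements are block matrices \<open>diag(I\<^sub>m, B)\<close> with \<open>B\<close> of size \<open>n - m\<close>.
\<close>

definition partial_monomial_sub :: "('g, 'x) monoid_scheme \<Rightarrow> nat \<Rightarrow> nat \<Rightarrow> 'g zmat set" where
  "partial_monomial_sub G m n =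
     {A \<in> carrier (partial_monomial G n). \<forall>i\<in>{1..m}. A i i = Some \<one>\<^bsub>G\<^esub>}"

definition monomial_group_sub :: "('g, 'x) monoid_scheme \<Rightarrow> nat \<Rightarrow> nat \<Rightarrow> 'g zmat set" where
  "monomial_group_sub G m n = carrier (monomial_group G n) \<inter> partial_monomial_sub G m n"


section \<open>Semigroup algebras, algebra homomorphisms, centralizers\<close>

text \<open>
  Elements are the finitely supported \<open>F\<close>-valued functions on \<open>carrier S\<close>, extended by \<open>0\<close>
  outside of \<open>carrier S\<close>. Hence the algebra of a subsemigroup is literally contained in the
  algebra of the whole semigroup.
\<close>

definition supp :: "('f, 'x) ring_scheme \<Rightarrow> ('s \<Rightarrow> 'f) \<Rightarrow> 's set" where
  "supp F a = {s. a s \<noteq> \<zero>\<^bsub>F\<^esub>}"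

definition basis_elt :: "('f, 'x) ring_scheme \<Rightarrow> 's \<Rightarrow> 's \<Rightarrow> 'f" where
  "basis_elt F s = (\<lambda>t. if t = s then \<one>\<^bsub>F\<^esub> else \<zero>\<^bsub>F\<^esub>)"

definition semigroup_algebra ::
    "('f, 'x) ring_scheme \<Rightarrow> ('s, 'y) monoid_scheme \<Rightarrow> ('f, 's \<Rightarrow> 'f) module" where
  "semigroup_algebra F S =
     \<lparr>carrier = {a. range a \<subseteq> carrier F \<and> supp F a \<subseteq> carrier S \<and> finite (supp F a)},
      monoid.mult = (\<lambda>a b t. \<Oplus>\<^bsub>F\<^esub>x\<in>supp F a. \<Oplus>\<^bsub>F\<^esub>y\<in>supp F b.
                               if x \<otimes>\<^bsub>S\<^esub> y = t then a x \<otimes>\<^bsub>F\<^esub> b y else \<zero>\<^bsub>F\<^esub>),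
      one = basis_elt F \<one>\<^bsub>S\<^esub>,
      ring.zero = (\<lambda>t. \<zero>\<^bsub>F\<^esub>),
      ring.add = (\<lambda>a b t. a t \<oplus>\<^bsub>F\<^esub> b t),
      module.smult = (\<lambda>c a t. c \<otimes>\<^bsub>F\<^esub> a t)\<rparr>"

definition algebra_hom ::
    "('f, 'x) ring_scheme \<Rightarrow> ('f, 'a, 'y) module_scheme \<Rightarrow> ('f, 'b, 'z) module_scheme \<Rightarrow> ('a \<Rightarrow> 'b) set"
  where
  "algebra_hom F A B =
     {h \<in> ring_hom A B. \<forall>c\<in>carrier F. \<forall>a\<in>carrier A. h (c \<odot>\<^bsub>A\<^esub> a) = c \<odot>\<^bsub>B\<^esub> h a}"

definition centralizer :: "('a, 'x) monoid_scheme \<Rightarrow> 'a set \<Rightarrow> 'a set" where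
  "centralizer A T = {a \<in> carrier A. \<forall>x\<in>T. a \<otimes>\<^bsub>A\<^esub> x = x \<otimes>\<^bsub>A\<^esub> a}"

definition partial_monomial_centralizer ::
    "('f, 'x) ring_scheme \<Rightarrow> ('g, 'y) monoid_scheme \<Rightarrow> nat \<Rightarrow> nat \<Rightarrow> ('g zmat \<Rightarrow> 'f) set"
  where
  "partial_monomial_centralizer F G m n =
     centralizer (semigroup_algebra F (partial_monomial G n))
       (basis_elt F ` partial_monomial_sub G m n)"

definition monomial_centralizer ::
    "('f, 'x) ring_scheme \<Rightarrow> ('g, 'y) monoid_scheme \<Rightarrow> nat \<Rightarrow> nat \<Rightarrow> ('g zmat \<Rightarrow> 'f) set"
  where
  "monomial_centralizer F G m n =
     centralizer (semigroup_algebra F (monomial_group G n))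
       (basis_elt F ` monomial_group_sub G m n)"


section \<open>Existence of the homomorphism killing the idempotents \<open>\<epsilon>\<^sub>j\<close>\<close>

text \<open>
  Restriction of functions to the monomial group is an algebra homomorphism because the
  complement of the monomial group is an ideal of the semigroup.
\<close>

lemma zmat_mult_nonzeroD:
  assumes "zmat_mult G n A B i j \<noteq> None"
  shows "\<exists>k\<in>{1..n}. A i k \<noteq> None \<and> B k j \<noteq> None"
proof -
  have "foldr (\<lambda>k s. zero_add (zero_mult G (A i k) (B k j)) s) ks None \<noteq> None \<Longrightarrow>
          \<exists>k\<in>set ks. A i k \<noteq> None \<and> B k j \<noteq> None" for ks
  proof (induction ks)
    case (Cons k ks)
    then show ?case
      by (cases "A i k"; cases "B k j") auto
  qed simp
  from this[of "[1..<Suc n]"] assms show ?thesis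
    by (auto simp: zmat_mult_def atLeastLessThanSuc_atLeastAtMost simp del: upt_Suc)
qed

lemma zmats_index: "A \<in> zmats G n \<Longrightarrow> A i j \<noteq> None \<Longrightarrow> i \<in> {1..n} \<and> j \<in> {1..n}"
  unfolding zmats_def by blast

lemma inj_total_relation_surj:
  fixes R :: "nat \<Rightarrow> nat \<Rightarrow> bool"
  assumes "\<forall>i\<in>{1..n}. \<exists>j\<in>{1..n}. R i j"
    and "\<And>i i' j. R i j \<Longrightarrow> R i' j \<Longrightarrow> i = i'"
    and "j \<in> {1..n}"
  shows "\<exists>i\<in>{1..n}. R i j"
proof -
  from assms(1) obtain f where f: "\<forall>i\<in>{1..n}. f i \<in> {1..n} \<and> R i (f i)"
    by metis
  have "inj_on f {1..n}"
    using f assms(2) by (metis inj_onI)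
  then have "f ` {1..n} = {1..n}"
    using f by (intro endo_inj_surj) auto
  then show ?thesis
    using f assms(3) by (metis image_iff)
qed

lemma partial_monomialD:
  assumes "A \<in> carrier (partial_monomial G n)"
  shows "A \<in> zmats G n"
    and "A i j \<noteq> None \<Longrightarrow> A i j' \<noteq> None \<Longrightarrow> j = j'"
    and "A i j \<noteq> None \<Longrightarrow> A i' j \<noteq> None \<Longrightarrow> i = i'"
proof -
  show A: "A \<in> zmats G n"
    using assms by (simp add: partial_monomial_def)
  have *: "\<forall>i\<in>{1..n}. \<exists>\<^sub>\<le>\<^sub>1 j. A i j \<noteq> None" "\<forall>j\<in>{1..n}. \<exists>\<^sub>\<le>\<^sub>1 i. A i j \<noteq> None"
    using assms by (simp_all add: partial_monomial_def)
  show "j = j'" if "A i j \<noteq> None" "A i j' \<noteq> None"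
    using bspec[OF *(1), of i] zmats_index[OF A that(1)] that unfolding Uniq_def by blast
  show "i = i'" if "A i j \<noteq> None" "A i' j \<noteq> None"
    using bspec[OF *(2), of j] zmats_index[OF A that(1)] that unfolding Uniq_def by blast
qed

lemma monomial_group_iff:
  "A \<in> carrier (monomial_group G n) \<longleftrightarrow>
     A \<in> carrier (partial_monomial G n) \<and>
     (\<forall>i\<in>{1..n}. \<exists>j\<in>{1..n}. A i j \<noteq> None) \<and> (\<forall>j\<in>{1..n}. \<exists>i\<in>{1..n}. A i j \<noteq> None)"
proof (cases "A \<in> zmats G n")
  case True
  have ex1: "(\<exists>!x. P x) \<longleftrightarrow> (\<exists>\<^sub>\<le>\<^sub>1 x. P x) \<and> (\<exists>x. P x)" for P :: "nat \<Rightarrow> bool"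
    unfolding Uniq_def by blast
  have "(\<exists>j. A i j \<noteq> None) \<longleftrightarrow> (\<exists>j\<in>{1..n}. A i j \<noteq> None)"
    and "(\<exists>j. A j i \<noteq> None) \<longleftrightarrow> (\<exists>j\<in>{1..n}. A j i \<noteq> None)" for i
    using zmats_index[OF True] by blast+
  then show ?thesis
    using True by (simp only: monomial_group_def partial_monomial_def ex1 partial_object.simps
        mem_Collect_eq ball_conj_distrib simp_thms conj_ac)
next
  case False
  then show ?thesis
    by (simp add: monomial_group_def partial_monomial_def)
qed

lemma zmat_mult_monomialD:
  assumes A: "A \<in> carrier (partial_monomial G n)" and B: "B \<in> carrier (partial_monomial G n)"
    and AB: "zmat_mult G n A B \<in> carrier (monomial_group G n)"
  shows "A \<in> carrier (monomial_group G n)" and "B \<in> carrier (monomial_group G n)"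
proof -
  have rowA: "\<forall>i\<in>{1..n}. \<exists>j\<in>{1..n}. A i j \<noteq> None"
    and colB: "\<forall>j\<in>{1..n}. \<exists>i\<in>{1..n}. B i j \<noteq> None"
    using AB zmat_mult_nonzeroD[of G n A B] unfolding monomial_group_iff by meson+
  have "\<forall>j\<in>{1..n}. \<exists>i\<in>{1..n}. A i j \<noteq> None"
    using inj_total_relation_surj[of n "\<lambda>i j. A i j \<noteq> None"] rowA partial_monomialD(3)[OF A] by blast
  then show "A \<in> carrier (monomial_group G n)"
    using A rowA by (simp add: monomial_group_iff)
  have "\<forall>j\<in>{1..n}. \<exists>i\<in>{1..n}. B j i \<noteq> None"
    using inj_total_relation_surj[of n "\<lambda>i j. B j i \<noteq> None"] colB partial_monomialD(2)[OF B] by blast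
  then show "B \<in> carrier (monomial_group G n)"
    using B colB by (simp add: monomial_group_iff)
qed

lemma foldr_zero_add_None:
  "(\<And>k. k \<in> set ks \<Longrightarrow> f k = None) \<Longrightarrow> foldr (\<lambda>k s. zero_add (f k) s) ks None = None"
  by (induction ks) auto

lemma foldr_zero_add_single:
  assumes "distinct ks" and "k0 \<in> set ks" and "\<And>k. k \<in> set ks \<Longrightarrow> k \<noteq> k0 \<Longrightarrow> f k = None"
  shows "foldr (\<lambda>k s. zero_add (f k) s) ks None = f k0"
  using assms
proof (induction ks)
  case (Cons k ks)
  show ?case
  proof (cases "k = k0")
    case True
    then have "foldr (\<lambda>k s. zero_add (f k) s) ks None = None"
      using Cons.prems by (intro foldr_zero_add_None) auto
    then show ?thesis
      using True by (cases "f k0") auto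
  next
    case False
    then show ?thesis
      using Cons by auto
  qed
qed simp

lemma zmat_mult_Some:
  assumes "A \<in> carrier (partial_monomial G n)" and "A i k = Some g" and "B k j = Some h"
  shows "zmat_mult G n A B i j = Some (g \<otimes>\<^bsub>G\<^esub> h)"
proof -
  have k: "k \<in> set [1..<Suc n]"
    using zmats_index[OF partial_monomialD(1)[OF assms(1)], of i k] assms(2) by auto
  have "A i k' = None" if "k' \<noteq> k" for k'
    using partial_monomialD(2)[OF assms(1), of i k k'] assms(2) that by (metis option.distinct(1))
  then show ?thesis
    unfolding zmat_mult_def using assms(2,3)
    by (subst foldr_zero_add_single[OF _ k]) auto
qed

lemma zmat_mult_nonzero_iff:
  assumes "A \<in> carrier (partial_monomial G n)"
  shows "zmat_mult G n A B i j \<noteq> None \<longleftrightarrow> (\<exists>k. A i k \<noteq> None \<and> B k j \<noteq> None)"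
  using zmat_mult_nonzeroD[of G n A B i j] zmat_mult_Some[OF assms, of i _ _ B j] by fastforce

lemma partial_monomial_mult_closed:
  assumes "group G"
    and A: "A \<in> carrier (partial_monomial G n)" and B: "B \<in> carrier (partial_monomial G n)"
  shows "zmat_mult G n A B \<in> carrier (partial_monomial G n)"
proof -
  have "i \<in> {1..n} \<and> j \<in> {1..n} \<and> g \<in> carrier G" if "zmat_mult G n A B i j = Some g" for i j g
  proof -
    have "zmat_mult G n A B i j \<noteq> None"
      using that by simp
    from zmat_mult_nonzeroD[OF this] obtain k where "A i k \<noteq> None" "B k j \<noteq> None"
      by blast
    then obtain a b where k: "A i k = Some a" "B k j = Some b"
      by auto
    then have "g = a \<otimes>\<^bsub>G\<^esub> b"
      using zmat_mult_Some[OF A k(1), of B j b] k(2) that by simp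
    moreover have "i \<in> {1..n}" "j \<in> {1..n}" "a \<in> carrier G" "b \<in> carrier G"
      using partial_monomialD(1)[OF A] partial_monomialD(1)[OF B] k unfolding zmats_def by blast+
    ultimately show ?thesis
      using group.is_monoid[OF assms(1)] by (simp add: monoid.m_closed)
  qed
  then have "zmat_mult G n A B \<in> zmats G n"
    unfolding zmats_def by blast
  moreover have "j = j'" if "zmat_mult G n A B i j \<noteq> None" "zmat_mult G n A B i j' \<noteq> None" for i j j'
    using that partial_monomialD(2)[OF A] partial_monomialD(2)[OF B]
    unfolding zmat_mult_nonzero_iff[OF A] by metis
  moreover have "i = i'" if "zmat_mult G n A B i j \<noteq> None" "zmat_mult G n A B i' j \<noteq> None" for i i' j
    using that partial_monomialD(3)[OF A] partial_monomialD(3)[OF B]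
    unfolding zmat_mult_nonzero_iff[OF A] by metis
  ultimately show ?thesis
    by (simp add: partial_monomial_def Uniq_def)
qed

lemma monomial_group_mult_closed:
  assumes "group G"
    and A: "A \<in> carrier (monomial_group G n)" and B: "B \<in> carrier (monomial_group G n)"
  shows "zmat_mult G n A B \<in> carrier (monomial_group G n)"
proof -
  have A': "A \<in> carrier (partial_monomial G n)" and B': "B \<in> carrier (partial_monomial G n)"
    using A B by (simp_all add: monomial_group_iff)
  have "\<exists>j\<in>{1..n}. zmat_mult G n A B i j \<noteq> None" if "i \<in> {1..n}" for i
  proof -
    obtain k where "k \<in> {1..n}" "A i k \<noteq> None"
      using A \<open>i \<in> {1..n}\<close> unfolding monomial_group_iff by blast
    moreover then obtain j where "j \<in> {1..n}" "B k j \<noteq> None"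
      using B unfolding monomial_group_iff by blast
    ultimately show ?thesis
      using zmat_mult_nonzero_iff[OF A'] by blast
  qed
  moreover have "\<exists>i\<in>{1..n}. zmat_mult G n A B i j \<noteq> None" if "j \<in> {1..n}" for j
  proof -
    obtain k where "k \<in> {1..n}" "B k j \<noteq> None"
      using B \<open>j \<in> {1..n}\<close> unfolding monomial_group_iff by blast
    moreover then obtain i where "i \<in> {1..n}" "A i k \<noteq> None"
      using A unfolding monomial_group_iff by blast
    ultimately show ?thesis
      using zmat_mult_nonzero_iff[OF A'] by blast
  qed
  ultimately show ?thesis
    using partial_monomial_mult_closed[OF assms(1) A' B'] by (simp add: monomial_group_iff)
qed

definition restrict_algebra ::
    "('f, 'x) ring_scheme \<Rightarrow> ('g, 'y) monoid_scheme \<Rightarrow> nat \<Rightarrow> ('g zmat \<Rightarrow> 'f) \<Rightarrow> ('g zmat \<Rightarrow> 'f)"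
  where
  "restrict_algebra F G n a = (\<lambda>A. if A \<in> carrier (monomial_group G n) then a A else \<zero>\<^bsub>F\<^esub>)"

lemma restrict_algebra_hom:
  fixes F :: "('f, 'x) ring_scheme" and G :: "('g, 'y) monoid_scheme"
  assumes "field F" and "group G"
  shows "restrict_algebra F G n \<in> algebra_hom F (semigroup_algebra F (partial_monomial G n))
           (semigroup_algebra F (monomial_group G n))"
    and "a \<in> carrier (semigroup_algebra F (monomial_group G n)) \<Longrightarrow> restrict_algebra F G n a = a"
    and "j \<in> {1..n} \<Longrightarrow> restrict_algebra F G n (basis_elt F (zmat_eps G n j)) =
           \<zero>\<^bsub>semigroup_algebra F (monomial_group G n)\<^esub>"
proof -
  interpret F: field F by fact
  let ?M = "partial_monomial G n" and ?H = "monomial_group G n" and ?r = "restrict_algebra F G n"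
  have one: "zmat_one G n \<in> carrier ?H"
    using group.is_monoid[OF assms(2)]
    by (auto simp: monomial_group_def zmats_def zmat_one_def monoid.one_closed)
  have supp_r: "supp F (?r a) = supp F a \<inter> carrier ?H" for a
    by (auto simp: supp_def restrict_algebra_def)
  show "?r a = a" if "a \<in> carrier (semigroup_algebra F ?H)"
  proof
    fix A
    have "A \<notin> carrier ?H \<Longrightarrow> a A = \<zero>\<^bsub>F\<^esub>"
      using that by (auto simp: semigroup_algebra_def supp_def)
    then show "?r a A = a A"
      by (simp add: restrict_algebra_def)
  qed
  show "?r (basis_elt F (zmat_eps G n j)) = \<zero>\<^bsub>semigroup_algebra F ?H\<^esub>" if "j \<in> {1..n}"
  proof -
    have "zmat_eps G n j j k = None" for k
      by (simp add: zmat_eps_def)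
    then have "zmat_eps G n j \<notin> carrier ?H"
      using that monomial_group_iff[of "zmat_eps G n j" G n] by metis
    then show ?thesis
      by (intro ext) (auto simp: semigroup_algebra_def restrict_algebra_def basis_elt_def)
  qed
  have mult: "?r (a \<otimes>\<^bsub>semigroup_algebra F ?M\<^esub> b) = ?r a \<otimes>\<^bsub>semigroup_algebra F ?H\<^esub> ?r b"
    if a: "a \<in> carrier (semigroup_algebra F ?M)" and b: "b \<in> carrier (semigroup_algebra F ?M)"
    for a b
  proof
    fix t
    let ?f = "\<lambda>x y. if zmat_mult G n x y = t then a x \<otimes>\<^bsub>F\<^esub> b y else \<zero>\<^bsub>F\<^esub>"
    have [simp]: "a x \<in> carrier F" "b x \<in> carrier F" for x
      using a b by (auto simp: semigroup_algebra_def)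
    have fin: "finite (supp F a)" "finite (supp F b)"
      using a b by (auto simp: semigroup_algebra_def)
    have sub: "supp F a \<subseteq> carrier ?M" "supp F b \<subseteq> carrier ?M"
      using a b by (auto simp: semigroup_algebra_def)
    have closed [simp]: "(\<Oplus>\<^bsub>F\<^esub>y\<in>Y. ?f x y) \<in> carrier F" for x Y
      by (rule F.finsum_closed) auto
    have R: "(?r a \<otimes>\<^bsub>semigroup_algebra F ?H\<^esub> ?r b) t =
        (\<Oplus>\<^bsub>F\<^esub>x\<in>supp F a \<inter> carrier ?H. \<Oplus>\<^bsub>F\<^esub>y\<in>supp F b \<inter> carrier ?H. ?f x y)"
    proof -
      have "(?r a \<otimes>\<^bsub>semigroup_algebra F ?H\<^esub> ?r b) t =
          (\<Oplus>\<^bsub>F\<^esub>x\<in>supp F a \<inter> carrier ?H. \<Oplus>\<^bsub>F\<^esub>y\<in>supp F b \<inter> carrier ?H.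
             if zmat_mult G n x y = t then ?r a x \<otimes>\<^bsub>F\<^esub> ?r b y else \<zero>\<^bsub>F\<^esub>)"
        by (simp add: semigroup_algebra_def supp_r) (simp add: monomial_group_def)
      also have "\<dots> = (\<Oplus>\<^bsub>F\<^esub>x\<in>supp F a \<inter> carrier ?H. \<Oplus>\<^bsub>F\<^esub>y\<in>supp F b \<inter> carrier ?H. ?f x y)"
        by (intro F.finsum_cong' refl) (auto simp: restrict_algebra_def intro!: F.finsum_closed)
      finally show ?thesis .
    qed
    show "?r (a \<otimes>\<^bsub>semigroup_algebra F ?M\<^esub> b) t = (?r a \<otimes>\<^bsub>semigroup_algebra F ?H\<^esub> ?r b) t"
    proof (cases "t \<in> carrier ?H")
      case True
      have inner: "(\<Oplus>\<^bsub>F\<^esub>y\<in>supp F b. ?f x y) = (\<Oplus>\<^bsub>F\<^esub>y\<in>supp F b \<inter> carrier ?H. ?f x y)"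
        if "x \<in> supp F a" for x
        using that True sub zmat_mult_monomialD(2)[of x G n]
        by (intro F.add.finprod_mono_neutral_cong_right) (auto simp: fin subset_iff)
      have "(\<Oplus>\<^bsub>F\<^esub>x\<in>supp F a. \<Oplus>\<^bsub>F\<^esub>y\<in>supp F b. ?f x y) =
          (\<Oplus>\<^bsub>F\<^esub>x\<in>supp F a. \<Oplus>\<^bsub>F\<^esub>y\<in>supp F b \<inter> carrier ?H. ?f x y)"
        by (rule F.finsum_cong') (simp_all add: inner)
      also have "\<dots> = (\<Oplus>\<^bsub>F\<^esub>x\<in>supp F a \<inter> carrier ?H. \<Oplus>\<^bsub>F\<^esub>y\<in>supp F b \<inter> carrier ?H. ?f x y)"
      proof (rule F.add.finprod_mono_neutral_cong_right)
        show "(\<Oplus>\<^bsub>F\<^esub>y\<in>supp F b \<inter> carrier ?H. ?f x y) = \<zero>\<^bsub>F\<^esub>"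
          if "x \<in> supp F a - supp F a \<inter> carrier ?H" for x
          using that True sub zmat_mult_monomialD(1)[of x G n] by (intro F.add.finprod_one_eqI) auto
      qed (simp_all add: fin)
      finally show ?thesis
        using True unfolding R by (simp add: restrict_algebra_def semigroup_algebra_def partial_monomial_def)
    next
      case False
      have "(\<Oplus>\<^bsub>F\<^esub>x\<in>supp F a \<inter> carrier ?H. \<Oplus>\<^bsub>F\<^esub>y\<in>supp F b \<inter> carrier ?H. ?f x y) = \<zero>\<^bsub>F\<^esub>"
        using False monomial_group_mult_closed[OF assms(2)]
        by (intro F.add.finprod_one_eqI) auto
      then show ?thesis
        using False unfolding R by (simp add: restrict_algebra_def)
    qed
  qed
  show "?r \<in> algebra_hom F (semigroup_algebra F ?M) (semigroup_algebra F ?H)"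
    unfolding algebra_hom_def mem_Collect_eq
  proof (intro conjI ballI ring_hom_memI)
    show "?r (x \<otimes>\<^bsub>semigroup_algebra F ?M\<^esub> y) = ?r x \<otimes>\<^bsub>semigroup_algebra F ?H\<^esub> ?r y"
      if "x \<in> carrier (semigroup_algebra F ?M)" "y \<in> carrier (semigroup_algebra F ?M)" for x y
      using mult that .
    show "?r x \<in> carrier (semigroup_algebra F ?H)" if "x \<in> carrier (semigroup_algebra F ?M)" for x
      using that supp_r[of x] by (auto simp: semigroup_algebra_def restrict_algebra_def)
    show "?r \<one>\<^bsub>semigroup_algebra F ?M\<^esub> = \<one>\<^bsub>semigroup_algebra F ?H\<^esub>"
      using one by (auto simp: semigroup_algebra_def restrict_algebra_def basis_elt_def
          partial_monomial_def monomial_group_def)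
    show "?r (x \<oplus>\<^bsub>semigroup_algebra F ?M\<^esub> y) = ?r x \<oplus>\<^bsub>semigroup_algebra F ?H\<^esub> ?r y" for x y
      by (rule ext) (simp add: semigroup_algebra_def restrict_algebra_def)
    show "?r (c \<odot>\<^bsub>semigroup_algebra F ?M\<^esub> x) = c \<odot>\<^bsub>semigroup_algebra F ?H\<^esub> ?r x"
      if "c \<in> carrier F" for c x
      using that by (intro ext) (simp add: semigroup_algebra_def restrict_algebra_def)
  qed
qed

end

theory Submission
  imports Defs
begin

text \<open>
  Let \<open>e\<close> be the product of the elements \<open>1 - \<epsilon>\<^sub>j\<close> in the semigroup algebra. The idempotents
  \<open>\<epsilon>\<^sub>j\<close> commute, so \<open>e\<close> annihilates each of them, and hence every singular matrix \<open>x\<close>, because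
  \<open>x = \<epsilon>\<^sub>i x = x \<epsilon>\<^sub>j\<close> for a zero row \<open>i\<close> and a zero column \<open>j\<close>. The singular matrices span an ideal
  that contains \<open>1 - e\<close>, so \<open>e r (1 - e) = 0 = (1 - e) r e\<close> for all \<open>r\<close>: the element \<open>e\<close> is
  central. If \<open>a\<close> commutes with the invertible elements of the subsemigroup, then so does \<open>a e\<close>,
  which also commutes with the singular ones, both products being \<open>0\<close>. Finally \<open>\<Phi> e = 1\<close>, so
  \<open>\<Phi> (a e) = a\<close>.
\<close>

section \<open>The algebra of a monoid\<close>

lemma (in abelian_monoid) finsum_swap:
  assumes "finite A" and "finite B" and "\<And>x y. x \<in> A \<Longrightarrow> y \<in> B \<Longrightarrow> f x y \<in> carrier G"
  shows "(\<Oplus>x\<in>A. \<Oplus>y\<in>B. f x y) = (\<Oplus>y\<in>B. \<Oplus>x\<in>A. f x y)"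
  using assms(1,3)
proof (induction A rule: finite_induct)
  case empty
  then show ?case
    by (simp add: finsum_zero)
next
  case (insert a A)
  have "(\<Oplus>x\<in>insert a A. \<Oplus>y\<in>B. f x y) = (\<Oplus>y\<in>B. f a y) \<oplus> (\<Oplus>y\<in>B. \<Oplus>x\<in>A. f x y)"
    using insert by (subst finsum_insert) (auto intro!: finsum_closed)
  also have "\<dots> = (\<Oplus>y\<in>B. f a y \<oplus> (\<Oplus>x\<in>A. f x y))"
    using insert.prems by (intro finsum_addf[symmetric]) (auto intro!: finsum_closed)
  also have "\<dots> = (\<Oplus>y\<in>B. \<Oplus>x\<in>insert a A. f x y)"
    using insert by (intro finsum_cong' refl) (auto intro!: finsum_closed a_closed simp: finsum_insert Pi_def)
  finally show ?case .
qed

text \<open>Only the term \<open>j = i\<close> can survive. The predicate \<open>P\<close> carries a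
  second condition on the index, so that a sum over intermediate products can be collapsed in one
  step.\<close>

lemma (in abelian_monoid) finsum_delta:
  assumes "finite A" and "i \<in> A" and "P i \<Longrightarrow> c \<in> carrier G"
  shows "(\<Oplus>j\<in>A. if i = j \<and> P j then c else \<zero>) = (if P i then c else \<zero>)"
proof -
  have "(\<Oplus>j\<in>A. if i = j \<and> P j then c else \<zero>) = (\<Oplus>j\<in>A. if i = j then if P i then c else \<zero> else \<zero>)"
    using assms(3) by (intro finsum_cong' refl) auto
  also have "\<dots> = (if P i then c else \<zero>)"
    using finsum_singleton[OF assms(2,1), of "\<lambda>_. if P i then c else \<zero>"] assms(3) by auto
  finally show ?thesis .
qed

text \<open>The semigroup algebra and the group algebra of the theorem are both instances, so the
  algebra is developed once for an arbitrary monoid.\<close>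

locale monoid_algebra = R?: ring R + S: monoid S
  for R :: "('r, 'x) ring_scheme" (structure) and S :: "('s, 'y) monoid_scheme"
begin

abbreviation "\<A> \<equiv> semigroup_algebra R S"

lemma algebra_carrierD:
  assumes "a \<in> carrier \<A>"
  shows "a x \<in> carrier R" "finite (supp R a)" "supp R a \<subseteq> carrier S"
  using assms by (auto simp: semigroup_algebra_def)

text \<open>\<open>U\<close> only has to contain the support: for sums and products an upper bound
  is at hand, while cancellation makes the support itself awkward to describe.\<close>

lemma algebra_carrierI:
  assumes "\<And>x. a x \<in> carrier R" "finite U" "U \<subseteq> carrier S" "\<And>x. x \<notin> U \<Longrightarrow> a x = \<zero>"
  shows "a \<in> carrier \<A>"
proof -
  have "supp R a \<subseteq> U"
    using assms(4) by (auto simp: supp_def)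
  then show ?thesis
    using assms(1-3) finite_subset[of "supp R a" U] by (auto simp: semigroup_algebra_def)
qed

lemma add_eq: "(a \<oplus>\<^bsub>\<A>\<^esub> b) t = a t \<oplus> b t"
  by (simp add: semigroup_algebra_def)

lemma zero_eq: "\<zero>\<^bsub>\<A>\<^esub> t = \<zero>"
  by (simp add: semigroup_algebra_def)

text \<open>Terms outside the supports vanish, so the exact supports in the definition of the
  product may be replaced by any larger finite sets. This lets different products be summed over
  common index sets.\<close>

lemma mult_eq:
  assumes a: "a \<in> carrier \<A>" and b: "b \<in> carrier \<A>"
    and U: "finite U" "supp R a \<subseteq> U" and V: "finite V" "supp R b \<subseteq> V"
  shows "(a \<otimes>\<^bsub>\<A>\<^esub> b) t = (\<Oplus>x\<in>U. \<Oplus>y\<in>V. if x \<otimes>\<^bsub>S\<^esub> y = t then a x \<otimes> b y else \<zero>)"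
proof -
  note [simp] = algebra_carrierD(1,2)[OF a] algebra_carrierD(1,2)[OF b]
  have [simp]: "a x = \<zero>" if "x \<notin> supp R a" for x
    using that by (simp add: supp_def)
  have [simp]: "b x = \<zero>" if "x \<notin> supp R b" for x
    using that by (simp add: supp_def)
  have inner: "(\<Oplus>y\<in>V. if x \<otimes>\<^bsub>S\<^esub> y = t then a x \<otimes> b y else \<zero>) =
      (\<Oplus>y\<in>supp R b. if x \<otimes>\<^bsub>S\<^esub> y = t then a x \<otimes> b y else \<zero>)" for x
    using V by (intro R.add.finprod_mono_neutral_cong_right) auto
  have "(\<Oplus>x\<in>U. \<Oplus>y\<in>V. if x \<otimes>\<^bsub>S\<^esub> y = t then a x \<otimes> b y else \<zero>) =
      (\<Oplus>x\<in>supp R a. \<Oplus>y\<in>supp R b. if x \<otimes>\<^bsub>S\<^esub> y = t then a x \<otimes> b y else \<zero>)"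
    unfolding inner using U
    by (intro R.add.finprod_mono_neutral_cong_right)
      (auto intro!: R.finsum_closed R.add.finprod_one_eqI)
  then show ?thesis
    by (simp add: semigroup_algebra_def)
qed

text \<open>If \<open>t\<close> is not a product of support elements, every term of its coefficient
  is zero. The resulting finite bound serves as the index set for iterated products.\<close>

lemma mult_closed:
  assumes a: "a \<in> carrier \<A>" and b: "b \<in> carrier \<A>"
  shows "a \<otimes>\<^bsub>\<A>\<^esub> b \<in> carrier \<A>"
    and "supp R (a \<otimes>\<^bsub>\<A>\<^esub> b) \<subseteq> (\<lambda>(x, y). x \<otimes>\<^bsub>S\<^esub> y) ` (supp R a \<times> supp R b)" (is "_ \<subseteq> ?U")
proof -
  note [simp] = algebra_carrierD(1)[OF a] algebra_carrierD(1)[OF b]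
  note eq = mult_eq[OF a b algebra_carrierD(2)[OF a] subset_refl algebra_carrierD(2)[OF b] subset_refl]
  have zero: "(a \<otimes>\<^bsub>\<A>\<^esub> b) t = \<zero>" if "t \<notin> ?U" for t
    unfolding eq using that by (intro R.add.finprod_one_eqI) auto
  show "a \<otimes>\<^bsub>\<A>\<^esub> b \<in> carrier \<A>"
  proof (rule algebra_carrierI[of _ ?U])
    show "(a \<otimes>\<^bsub>\<A>\<^esub> b) t \<in> carrier R" for t
      unfolding eq by (auto intro!: R.finsum_closed)
    show "finite ?U" "?U \<subseteq> carrier S"
      using algebra_carrierD(2,3)[OF a] algebra_carrierD(2,3)[OF b] by auto
  qed (rule zero)
  show "supp R (a \<otimes>\<^bsub>\<A>\<^esub> b) \<subseteq> ?U"
    using zero unfolding supp_def by blast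
qed

text \<open>Both sides are expanded into fourfold sums in which the intermediate product is a
  summation variable: \<open>u\<close> for \<open>x y\<close> on the left, \<open>v\<close> for
  \<open>y z\<close> on the right. Eliminating \<open>u\<close> leaves a sum over triples, where
  associativity in \<open>S\<close> applies; then \<open>v\<close> is introduced and the expansion
  is run backwards.\<close>

lemma mult_assoc:
  assumes a: "a \<in> carrier \<A>" and b: "b \<in> carrier \<A>" and c: "c \<in> carrier \<A>"
  shows "(a \<otimes>\<^bsub>\<A>\<^esub> b) \<otimes>\<^bsub>\<A>\<^esub> c = a \<otimes>\<^bsub>\<A>\<^esub> (b \<otimes>\<^bsub>\<A>\<^esub> c)"
proof
  fix t
  let ?A = "supp R a" and ?B = "supp R b" and ?C = "supp R c"
  let ?U = "(\<lambda>(x, y). x \<otimes>\<^bsub>S\<^esub> y) ` (?A \<times> ?B)" and ?V = "(\<lambda>(x, y). x \<otimes>\<^bsub>S\<^esub> y) ` (?B \<times> ?C)"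
  let ?w = "\<lambda>x y z. a x \<otimes> b y \<otimes> c z"
  note [simp] = algebra_carrierD(1)[OF a] algebra_carrierD(1)[OF b] algebra_carrierD(1)[OF c]
  note fin [simp] = algebra_carrierD(2)[OF a] algebra_carrierD(2)[OF b] algebra_carrierD(2)[OF c]
  \<comment> \<open>Rotation puts the termwise equation first, so that repeated uses of
    \<open>cong\<close> descend into nested sums.\<close>
  note cong = R.finsum_cong'[OF refl, rotated]
  have [simp]: "finite ?U" "finite ?V"
    by simp_all
  have "((a \<otimes>\<^bsub>\<A>\<^esub> b) \<otimes>\<^bsub>\<A>\<^esub> c) t =
      (\<Oplus>u\<in>?U. \<Oplus>z\<in>?C. if u \<otimes>\<^bsub>S\<^esub> z = t then (a \<otimes>\<^bsub>\<A>\<^esub> b) u \<otimes> c z else \<zero>)"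
    by (rule mult_eq[OF mult_closed(1)[OF a b] c]) (simp_all add: mult_closed(2)[OF a b])
  also have "\<dots> = (\<Oplus>u\<in>?U. \<Oplus>z\<in>?C. \<Oplus>x\<in>?A. \<Oplus>y\<in>?B.
      if x \<otimes>\<^bsub>S\<^esub> y = u \<and> u \<otimes>\<^bsub>S\<^esub> z = t then ?w x y z else \<zero>)"
  proof (intro R.finsum_cong' refl)
    fix u z
    show "(if u \<otimes>\<^bsub>S\<^esub> z = t then (a \<otimes>\<^bsub>\<A>\<^esub> b) u \<otimes> c z else \<zero>) =
      (\<Oplus>x\<in>?A. \<Oplus>y\<in>?B. if x \<otimes>\<^bsub>S\<^esub> y = u \<and> u \<otimes>\<^bsub>S\<^esub> z = t then ?w x y z else \<zero>)"
    proof (cases "u \<otimes>\<^bsub>S\<^esub> z = t")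
      case True
      have "(a \<otimes>\<^bsub>\<A>\<^esub> b) u \<otimes> c z =
          (\<Oplus>x\<in>?A. \<Oplus>y\<in>?B. (if x \<otimes>\<^bsub>S\<^esub> y = u then a x \<otimes> b y else \<zero>) \<otimes> c z)"
        by (subst mult_eq[OF a b fin(1) subset_refl fin(2) subset_refl]) (auto intro!: R.finsum_cong' R.finsum_closed simp: R.finsum_ldistr Pi_def)
      also have "\<dots> = (\<Oplus>x\<in>?A. \<Oplus>y\<in>?B. if x \<otimes>\<^bsub>S\<^esub> y = u then ?w x y z else \<zero>)"
        by (intro R.finsum_cong' refl) (auto intro!: R.finsum_closed)
      finally show ?thesis
        using True by simp
    qed (simp add: R.finsum_zero)
  qed (auto intro!: R.finsum_closed)
  also have "\<dots> = (\<Oplus>z\<in>?C. \<Oplus>u\<in>?U. \<Oplus>x\<in>?A. \<Oplus>y\<in>?B.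
      if x \<otimes>\<^bsub>S\<^esub> y = u \<and> u \<otimes>\<^bsub>S\<^esub> z = t then ?w x y z else \<zero>)"
    by (rule R.finsum_swap) (auto intro!: R.finsum_closed)
  also have "\<dots> = (\<Oplus>z\<in>?C. \<Oplus>x\<in>?A. \<Oplus>u\<in>?U. \<Oplus>y\<in>?B.
      if x \<otimes>\<^bsub>S\<^esub> y = u \<and> u \<otimes>\<^bsub>S\<^esub> z = t then ?w x y z else \<zero>)"
    by (rule cong, rule R.finsum_swap) (auto intro!: R.finsum_closed)
  also have "\<dots> = (\<Oplus>z\<in>?C. \<Oplus>x\<in>?A. \<Oplus>y\<in>?B. \<Oplus>u\<in>?U.
      if x \<otimes>\<^bsub>S\<^esub> y = u \<and> u \<otimes>\<^bsub>S\<^esub> z = t then ?w x y z else \<zero>)"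
    by (rule cong, rule cong, rule R.finsum_swap) (auto intro!: R.finsum_closed)
  \<comment> \<open>The condition on \<open>u\<close> forces \<open>u = x y\<close>, which lies in
    the index set, so the sum over \<open>u\<close> collapses.\<close>
  also have "\<dots> = (\<Oplus>z\<in>?C. \<Oplus>x\<in>?A. \<Oplus>y\<in>?B.
      if (x \<otimes>\<^bsub>S\<^esub> y) \<otimes>\<^bsub>S\<^esub> z = t then ?w x y z else \<zero>)"
    by (rule cong, rule cong, rule cong, rule R.finsum_delta) (auto intro!: R.finsum_closed)
  also have "\<dots> = (\<Oplus>x\<in>?A. \<Oplus>z\<in>?C. \<Oplus>y\<in>?B.
      if (x \<otimes>\<^bsub>S\<^esub> y) \<otimes>\<^bsub>S\<^esub> z = t then ?w x y z else \<zero>)"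
    by (rule R.finsum_swap) (auto intro!: R.finsum_closed)
  also have "\<dots> = (\<Oplus>x\<in>?A. \<Oplus>y\<in>?B. \<Oplus>z\<in>?C.
      if (x \<otimes>\<^bsub>S\<^esub> y) \<otimes>\<^bsub>S\<^esub> z = t then ?w x y z else \<zero>)"
    by (rule cong, rule R.finsum_swap) (auto intro!: R.finsum_closed)
  \<comment> \<open>Associativity in \<open>S\<close> enters here; the sum over \<open>v\<close> is
    a collapsing sum read from right to left.\<close>
  also have "\<dots> = (\<Oplus>x\<in>?A. \<Oplus>y\<in>?B. \<Oplus>z\<in>?C. \<Oplus>v\<in>?V.
      if y \<otimes>\<^bsub>S\<^esub> z = v \<and> x \<otimes>\<^bsub>S\<^esub> v = t then ?w x y z else \<zero>)"
  proof (intro R.finsum_cong' refl)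
    fix x y z assume "x \<in> ?A" "y \<in> ?B" "z \<in> ?C"
    then have "(x \<otimes>\<^bsub>S\<^esub> y) \<otimes>\<^bsub>S\<^esub> z = x \<otimes>\<^bsub>S\<^esub> (y \<otimes>\<^bsub>S\<^esub> z)" "y \<otimes>\<^bsub>S\<^esub> z \<in> ?V"
      using algebra_carrierD(3)[OF a] algebra_carrierD(3)[OF b] algebra_carrierD(3)[OF c]
      by (auto intro!: S.m_assoc)
    then show "(if (x \<otimes>\<^bsub>S\<^esub> y) \<otimes>\<^bsub>S\<^esub> z = t then ?w x y z else \<zero>) =
        (\<Oplus>v\<in>?V. if y \<otimes>\<^bsub>S\<^esub> z = v \<and> x \<otimes>\<^bsub>S\<^esub> v = t then ?w x y z else \<zero>)"
      by (subst R.finsum_delta) auto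
  qed (auto intro!: R.finsum_closed)
  also have "\<dots> = (\<Oplus>x\<in>?A. \<Oplus>y\<in>?B. \<Oplus>v\<in>?V. \<Oplus>z\<in>?C.
      if y \<otimes>\<^bsub>S\<^esub> z = v \<and> x \<otimes>\<^bsub>S\<^esub> v = t then ?w x y z else \<zero>)"
    by (rule cong, rule cong, rule R.finsum_swap) (auto intro!: R.finsum_closed)
  also have "\<dots> = (\<Oplus>x\<in>?A. \<Oplus>v\<in>?V. \<Oplus>y\<in>?B. \<Oplus>z\<in>?C.
      if y \<otimes>\<^bsub>S\<^esub> z = v \<and> x \<otimes>\<^bsub>S\<^esub> v = t then ?w x y z else \<zero>)"
    by (rule cong, rule R.finsum_swap) (auto intro!: R.finsum_closed)
  also have "\<dots> = (\<Oplus>x\<in>?A. \<Oplus>v\<in>?V. if x \<otimes>\<^bsub>S\<^esub> v = t then a x \<otimes> (b \<otimes>\<^bsub>\<A>\<^esub> c) v else \<zero>)"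
  proof (intro R.finsum_cong' refl)
    fix x v
    show "(\<Oplus>y\<in>?B. \<Oplus>z\<in>?C. if y \<otimes>\<^bsub>S\<^esub> z = v \<and> x \<otimes>\<^bsub>S\<^esub> v = t then ?w x y z else \<zero>) =
        (if x \<otimes>\<^bsub>S\<^esub> v = t then a x \<otimes> (b \<otimes>\<^bsub>\<A>\<^esub> c) v else \<zero>)"
    proof (cases "x \<otimes>\<^bsub>S\<^esub> v = t")
      case True
      have "a x \<otimes> (b \<otimes>\<^bsub>\<A>\<^esub> c) v =
          (\<Oplus>y\<in>?B. \<Oplus>z\<in>?C. a x \<otimes> (if y \<otimes>\<^bsub>S\<^esub> z = v then b y \<otimes> c z else \<zero>))"
        by (subst mult_eq[OF b c fin(2) subset_refl fin(3) subset_refl]) (auto intro!: R.finsum_cong' R.finsum_closed simp: R.finsum_rdistr Pi_def)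
      also have "\<dots> = (\<Oplus>y\<in>?B. \<Oplus>z\<in>?C. if y \<otimes>\<^bsub>S\<^esub> z = v then ?w x y z else \<zero>)"
        by (intro R.finsum_cong' refl) (auto intro!: R.finsum_closed simp: R.m_assoc)
      finally show ?thesis
        using True by simp
    qed (simp add: R.finsum_zero)
  qed (auto intro!: R.finsum_closed simp: algebra_carrierD(1)[OF mult_closed(1)[OF b c]])
  also have "\<dots> = (a \<otimes>\<^bsub>\<A>\<^esub> (b \<otimes>\<^bsub>\<A>\<^esub> c)) t"
    by (rule mult_eq[OF a mult_closed(1)[OF b c], symmetric]) (simp_all add: mult_closed(2)[OF b c])
  finally show "((a \<otimes>\<^bsub>\<A>\<^esub> b) \<otimes>\<^bsub>\<A>\<^esub> c) t = (a \<otimes>\<^bsub>\<A>\<^esub> (b \<otimes>\<^bsub>\<A>\<^esub> c)) t" .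
qed

lemma basis_elt_closed: "s \<in> carrier S \<Longrightarrow> basis_elt R s \<in> carrier \<A>"
  by (rule algebra_carrierI[of _ "{s}"]) (auto simp: basis_elt_def)

text \<open>An inclusion, not an equation: over the zero ring the support is empty.\<close>

lemma supp_basis_elt: "supp R (basis_elt R s) \<subseteq> {s}"
  by (auto simp: supp_def basis_elt_def)

text \<open>Left translation by \<open>s\<close> need not be injective, so several support elements
  can contribute to one coefficient. \<open>mult_eq\<close> is applied with the singleton
  \<open>{s}\<close> bounding the support of the basis element.\<close>

lemma basis_elt_mult:
  assumes s: "s \<in> carrier S" and a: "a \<in> carrier \<A>"
  shows "(basis_elt R s \<otimes>\<^bsub>\<A>\<^esub> a) t = (\<Oplus>y\<in>supp R a. if s \<otimes>\<^bsub>S\<^esub> y = t then a y else \<zero>)"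
  using algebra_carrierD[OF a]
  by (subst mult_eq[OF basis_elt_closed[OF s] a _ supp_basis_elt _ subset_refl])
    (auto simp: R.finsum_insert basis_elt_def Pi_def intro!: R.finsum_closed R.finsum_cong')

lemma mult_basis_elt:
  assumes s: "s \<in> carrier S" and a: "a \<in> carrier \<A>"
  shows "(a \<otimes>\<^bsub>\<A>\<^esub> basis_elt R s) t = (\<Oplus>x\<in>supp R a. if x \<otimes>\<^bsub>S\<^esub> s = t then a x else \<zero>)"
  using algebra_carrierD[OF a]
  by (subst mult_eq[OF a basis_elt_closed[OF s] _ subset_refl _ supp_basis_elt])
    (auto simp: R.finsum_insert basis_elt_def Pi_def intro!: R.finsum_closed R.finsum_cong')

lemma basis_elt_mult_basis_elt:
  assumes "s \<in> carrier S" and "u \<in> carrier S"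
  shows "basis_elt R s \<otimes>\<^bsub>\<A>\<^esub> basis_elt R u = basis_elt R (s \<otimes>\<^bsub>S\<^esub> u)"
proof
  fix t
  show "(basis_elt R s \<otimes>\<^bsub>\<A>\<^esub> basis_elt R u) t = basis_elt R (s \<otimes>\<^bsub>S\<^esub> u) t"
    by (subst mult_eq[OF basis_elt_closed[OF assms(1)] basis_elt_closed[OF assms(2)]
          _ supp_basis_elt _ supp_basis_elt])
      (auto simp: R.finsum_insert basis_elt_def)
qed

section \<open>Ring structure of the algebra\<close>

lemma ring_algebra: "ring \<A>"
proof (rule ringI)
  show "abelian_group \<A>"
  proof (rule abelian_groupI)
    show "x \<oplus>\<^bsub>\<A>\<^esub> y \<in> carrier \<A>" if "x \<in> carrier \<A>" "y \<in> carrier \<A>" for x y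
      using that algebra_carrierD[of x] algebra_carrierD[of y]
      by (intro algebra_carrierI[of _ "supp R x \<union> supp R y"]) (auto simp: add_eq supp_def)
    show "\<zero>\<^bsub>\<A>\<^esub> \<in> carrier \<A>"
      by (rule algebra_carrierI[of _ "{}"]) (auto simp: zero_eq)
    show "\<exists>y\<in>carrier \<A>. y \<oplus>\<^bsub>\<A>\<^esub> x = \<zero>\<^bsub>\<A>\<^esub>" if "x \<in> carrier \<A>" for x
    proof
      show "(\<lambda>t. \<ominus> x t) \<in> carrier \<A>"
        using algebra_carrierD[OF that] by (intro algebra_carrierI[of _ "supp R x"]) (auto simp: supp_def)
      show "(\<lambda>t. \<ominus> x t) \<oplus>\<^bsub>\<A>\<^esub> x = \<zero>\<^bsub>\<A>\<^esub>"
        using algebra_carrierD(1)[OF that] by (auto simp: add_eq zero_eq R.l_neg)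
    qed
  qed (auto simp: add_eq zero_eq algebra_carrierD(1) R.a_ac intro!: ext)
  show "monoid \<A>"
  proof (rule monoidI)
    have one: "\<one>\<^bsub>\<A>\<^esub> = basis_elt R \<one>\<^bsub>S\<^esub>"
      by (simp add: semigroup_algebra_def)
    show "\<one>\<^bsub>\<A>\<^esub> \<in> carrier \<A>"
      by (simp add: one basis_elt_closed)
    show "\<one>\<^bsub>\<A>\<^esub> \<otimes>\<^bsub>\<A>\<^esub> x = x" "x \<otimes>\<^bsub>\<A>\<^esub> \<one>\<^bsub>\<A>\<^esub> = x" if x: "x \<in> carrier \<A>" for x
    proof -
      \<comment> \<open>Both unit laws reduce to this: \<open>f\<close> is multiplication by the
        unit on one side, hence the identity on the support.\<close>
      have *: "(\<Oplus>y\<in>supp R x. if f y = t then x y else \<zero>) = x t"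
        if f: "\<And>y. y \<in> carrier S \<Longrightarrow> f y = y" for f t
      proof -
        \<comment> \<open>The point \<open>t\<close> is adjoined because it may lie outside the
          support, where the coefficient is zero.\<close>
        have "(\<Oplus>y\<in>supp R x. if f y = t then x y else \<zero>) = (\<Oplus>y\<in>insert t (supp R x). if y = t then x y else \<zero>)"
          using algebra_carrierD[OF x] f
          by (intro R.add.finprod_mono_neutral_cong_left) (auto simp: supp_def)
        also have "\<dots> = x t"
          using algebra_carrierD[OF x] R.add.finprod_singleton_swap[of t "insert t (supp R x)" x] by auto
        finally show ?thesis .
      qed
      show "\<one>\<^bsub>\<A>\<^esub> \<otimes>\<^bsub>\<A>\<^esub> x = x" "x \<otimes>\<^bsub>\<A>\<^esub> \<one>\<^bsub>\<A>\<^esub> = x"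
        by (rule ext, simp add: one basis_elt_mult mult_basis_elt x *)+
    qed
  qed (simp_all add: mult_closed mult_assoc)
  fix x y z assume xyz: "x \<in> carrier \<A>" "y \<in> carrier \<A>" "z \<in> carrier \<A>"
  have xy: "x \<oplus>\<^bsub>\<A>\<^esub> y \<in> carrier \<A>"
    using \<open>abelian_group \<A>\<close> xyz by (simp add: abelian_group.axioms(1) abelian_monoid.a_closed)
  \<comment> \<open>The products with \<open>x\<close>, with \<open>y\<close> and with their sum are
    all expanded over this common set, since cancellation may make the support of the sum smaller
    than the union.\<close>
  let ?X = "supp R x \<union> supp R y" and ?Z = "supp R z"
  note [simp] = xyz[THEN algebra_carrierD(1)] xyz[THEN algebra_carrierD(2)]
  have sub: "supp R (x \<oplus>\<^bsub>\<A>\<^esub> y) \<subseteq> ?X"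
    by (auto simp: supp_def add_eq)
  note cong = R.finsum_cong'[OF refl, rotated]
  show "(x \<oplus>\<^bsub>\<A>\<^esub> y) \<otimes>\<^bsub>\<A>\<^esub> z = x \<otimes>\<^bsub>\<A>\<^esub> z \<oplus>\<^bsub>\<A>\<^esub> y \<otimes>\<^bsub>\<A>\<^esub> z"
  proof
    fix t
    let ?f = "\<lambda>a u v. if u \<otimes>\<^bsub>S\<^esub> v = t then a u \<otimes> z v else \<zero>"
    have eq: "(a \<otimes>\<^bsub>\<A>\<^esub> z) t = (\<Oplus>u\<in>?X. \<Oplus>v\<in>?Z. ?f a u v)"
      if "a \<in> carrier \<A>" "supp R a \<subseteq> ?X" for a
      using that xyz by (intro mult_eq) auto
    have "(\<Oplus>u\<in>?X. \<Oplus>v\<in>?Z. ?f (x \<oplus>\<^bsub>\<A>\<^esub> y) u v) = (\<Oplus>u\<in>?X. \<Oplus>v\<in>?Z. ?f x u v \<oplus> ?f y u v)"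
      by (rule cong, rule cong) (auto simp: add_eq R.l_distr intro!: R.finsum_closed)
    also have "\<dots> = (\<Oplus>u\<in>?X. (\<Oplus>v\<in>?Z. ?f x u v) \<oplus> (\<Oplus>v\<in>?Z. ?f y u v))"
      by (rule cong, rule R.finsum_addf) (auto intro!: R.finsum_closed)
    also have "\<dots> = (\<Oplus>u\<in>?X. \<Oplus>v\<in>?Z. ?f x u v) \<oplus> (\<Oplus>u\<in>?X. \<Oplus>v\<in>?Z. ?f y u v)"
      by (rule R.finsum_addf) (auto intro!: R.finsum_closed)
    finally show "((x \<oplus>\<^bsub>\<A>\<^esub> y) \<otimes>\<^bsub>\<A>\<^esub> z) t = (x \<otimes>\<^bsub>\<A>\<^esub> z \<oplus>\<^bsub>\<A>\<^esub> y \<otimes>\<^bsub>\<A>\<^esub> z) t"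
      unfolding add_eq[of "x \<otimes>\<^bsub>\<A>\<^esub> z"]
      by (simp only: eq[OF xy sub] eq[OF xyz(1) Un_upper1] eq[OF xyz(2) Un_upper2])
  qed
  show "z \<otimes>\<^bsub>\<A>\<^esub> (x \<oplus>\<^bsub>\<A>\<^esub> y) = z \<otimes>\<^bsub>\<A>\<^esub> x \<oplus>\<^bsub>\<A>\<^esub> z \<otimes>\<^bsub>\<A>\<^esub> y"
  proof
    fix t
    let ?f = "\<lambda>a u v. if u \<otimes>\<^bsub>S\<^esub> v = t then z u \<otimes> a v else \<zero>"
    have eq: "(z \<otimes>\<^bsub>\<A>\<^esub> a) t = (\<Oplus>u\<in>?Z. \<Oplus>v\<in>?X. ?f a u v)"
      if "a \<in> carrier \<A>" "supp R a \<subseteq> ?X" for a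
      using that xyz by (intro mult_eq) auto
    have "(\<Oplus>u\<in>?Z. \<Oplus>v\<in>?X. ?f (x \<oplus>\<^bsub>\<A>\<^esub> y) u v) = (\<Oplus>u\<in>?Z. \<Oplus>v\<in>?X. ?f x u v \<oplus> ?f y u v)"
      by (rule cong, rule cong) (auto simp: add_eq R.r_distr intro!: R.finsum_closed)
    also have "\<dots> = (\<Oplus>u\<in>?Z. (\<Oplus>v\<in>?X. ?f x u v) \<oplus> (\<Oplus>v\<in>?X. ?f y u v))"
      by (rule cong, rule R.finsum_addf) (auto intro!: R.finsum_closed)
    also have "\<dots> = (\<Oplus>u\<in>?Z. \<Oplus>v\<in>?X. ?f x u v) \<oplus> (\<Oplus>u\<in>?Z. \<Oplus>v\<in>?X. ?f y u v)"
      by (rule R.finsum_addf) (auto intro!: R.finsum_closed)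
    finally show "(z \<otimes>\<^bsub>\<A>\<^esub> (x \<oplus>\<^bsub>\<A>\<^esub> y)) t = (z \<otimes>\<^bsub>\<A>\<^esub> x \<oplus>\<^bsub>\<A>\<^esub> z \<otimes>\<^bsub>\<A>\<^esub> y) t"
      unfolding add_eq[of "z \<otimes>\<^bsub>\<A>\<^esub> x"]
      by (simp only: eq[OF xy sub] eq[OF xyz(1) Un_upper1] eq[OF xyz(2) Un_upper2])
  qed
qed

text \<open>The coefficient of \<open>a b\<close> at \<open>t\<close> is the combination, with
  weights \<open>a s\<close>, of the coefficients of the products of \<open>s\<close> with
  \<open>b\<close>. Working with coefficients avoids writing \<open>a\<close> as a finite sum inside
  the algebra.\<close>

lemma mult_eq_zero_left:
  assumes a: "a \<in> carrier \<A>" and b: "b \<in> carrier \<A>"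
    and ann: "\<And>s. s \<in> supp R a \<Longrightarrow> basis_elt R s \<otimes>\<^bsub>\<A>\<^esub> b = \<zero>\<^bsub>\<A>\<^esub>"
  shows "a \<otimes>\<^bsub>\<A>\<^esub> b = \<zero>\<^bsub>\<A>\<^esub>"
proof
  fix t
  note [simp] = algebra_carrierD[OF a] algebra_carrierD[OF b]
  have "(\<Oplus>y\<in>supp R b. if s \<otimes>\<^bsub>S\<^esub> y = t then a s \<otimes> b y else \<zero>) = \<zero>" if "s \<in> supp R a" for s
  proof -
    have "(\<Oplus>y\<in>supp R b. if s \<otimes>\<^bsub>S\<^esub> y = t then a s \<otimes> b y else \<zero>) =
        (\<Oplus>y\<in>supp R b. a s \<otimes> (if s \<otimes>\<^bsub>S\<^esub> y = t then b y else \<zero>))"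
      by (intro R.finsum_cong' refl) auto
    also have "\<dots> = a s \<otimes> (\<Oplus>y\<in>supp R b. if s \<otimes>\<^bsub>S\<^esub> y = t then b y else \<zero>)"
      by (subst R.finsum_rdistr) auto
    also have "(\<Oplus>y\<in>supp R b. if s \<otimes>\<^bsub>S\<^esub> y = t then b y else \<zero>) = \<zero>"
      using basis_elt_mult[OF subsetD[OF algebra_carrierD(3)[OF a] that] b, of t] ann[OF that]
      by (auto simp: zero_eq)
    finally show ?thesis
      by simp
  qed
  then have "(\<Oplus>x\<in>supp R a. \<Oplus>y\<in>supp R b. if x \<otimes>\<^bsub>S\<^esub> y = t then a x \<otimes> b y else \<zero>) = \<zero>"
    by (rule R.add.finprod_one_eqI)
  then show "(a \<otimes>\<^bsub>\<A>\<^esub> b) t = \<zero>\<^bsub>\<A>\<^esub> t"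
    by (subst mult_eq[OF a b _ subset_refl _ subset_refl]) (auto simp: zero_eq)
qed

lemma mult_eq_zero_right:
  assumes a: "a \<in> carrier \<A>" and b: "b \<in> carrier \<A>"
    and ann: "\<And>s. s \<in> supp R a \<Longrightarrow> b \<otimes>\<^bsub>\<A>\<^esub> basis_elt R s = \<zero>\<^bsub>\<A>\<^esub>"
  shows "b \<otimes>\<^bsub>\<A>\<^esub> a = \<zero>\<^bsub>\<A>\<^esub>"
proof
  fix t
  note [simp] = algebra_carrierD[OF a] algebra_carrierD[OF b]
  have *: "(\<Oplus>y\<in>supp R b. if y \<otimes>\<^bsub>S\<^esub> s = t then b y \<otimes> a s else \<zero>) = \<zero>" if "s \<in> supp R a" for s
  proof -
    have "(\<Oplus>y\<in>supp R b. if y \<otimes>\<^bsub>S\<^esub> s = t then b y \<otimes> a s else \<zero>) =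
        (\<Oplus>y\<in>supp R b. (if y \<otimes>\<^bsub>S\<^esub> s = t then b y else \<zero>) \<otimes> a s)"
      by (intro R.finsum_cong' refl) auto
    also have "\<dots> = (\<Oplus>y\<in>supp R b. if y \<otimes>\<^bsub>S\<^esub> s = t then b y else \<zero>) \<otimes> a s"
      by (subst R.finsum_ldistr) auto
    also have "(\<Oplus>y\<in>supp R b. if y \<otimes>\<^bsub>S\<^esub> s = t then b y else \<zero>) = \<zero>"
      using mult_basis_elt[OF subsetD[OF algebra_carrierD(3)[OF a] that] b, of t] ann[OF that]
      by (auto simp: zero_eq)
    finally show ?thesis
      by simp
  qed
  have "(b \<otimes>\<^bsub>\<A>\<^esub> a) t = (\<Oplus>y\<in>supp R b. \<Oplus>s\<in>supp R a. if y \<otimes>\<^bsub>S\<^esub> s = t then b y \<otimes> a s else \<zero>)"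
    by (rule mult_eq[OF b a _ subset_refl _ subset_refl]) auto
  \<comment> \<open>After the interchange the outer index runs over the support of \<open>a\<close>,
    where the hypothesis applies.\<close>
  also have "\<dots> = (\<Oplus>s\<in>supp R a. \<Oplus>y\<in>supp R b. if y \<otimes>\<^bsub>S\<^esub> s = t then b y \<otimes> a s else \<zero>)"
    by (rule R.finsum_swap) auto
  also have "\<dots> = \<zero>"
    using * by (rule R.add.finprod_one_eqI)
  finally show "(b \<otimes>\<^bsub>\<A>\<^esub> a) t = \<zero>\<^bsub>\<A>\<^esub> t"
    by (simp add: zero_eq)
qed

end

section \<open>Products of complementary idempotents\<close>

text \<open>A list fixes the order of the factors, since the ring need not be commutative.\<close>

definition (in ring) prod_one_minus :: "'a list \<Rightarrow> 'a" where
  "prod_one_minus fs = foldr (\<lambda>f p. (\<one> \<ominus> f) \<otimes> p) fs \<one>"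

lemma (in ring) prod_one_minus_closed: "set fs \<subseteq> carrier R \<Longrightarrow> prod_one_minus fs \<in> carrier R"
  by (induction fs) (auto simp: prod_one_minus_def)

lemma (in ring) one_minus_commute:
  assumes "c \<in> carrier R" and "f \<in> carrier R" and "c \<otimes> f = f \<otimes> c"
  shows "c \<otimes> (\<one> \<ominus> f) = (\<one> \<ominus> f) \<otimes> c"
  using assms by (simp add: minus_eq r_distr l_distr r_minus l_minus)

lemma (in ring) prod_one_minus_commute:
  assumes c: "c \<in> carrier R" and "set fs \<subseteq> carrier R" and "\<And>f. f \<in> set fs \<Longrightarrow> c \<otimes> f = f \<otimes> c"
  shows "c \<otimes> prod_one_minus fs = prod_one_minus fs \<otimes> c"
  using assms(2,3)
proof (induction fs)
  case Nil
  then show ?case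
    using c by (simp add: prod_one_minus_def)
next
  case (Cons f fs)
  let ?p = "prod_one_minus fs" and ?q = "\<one> \<ominus> f"
  have closed: "?p \<in> carrier R" "?q \<in> carrier R"
    using Cons.prems(1) by (simp_all add: prod_one_minus_closed)
  have "c \<otimes> (?q \<otimes> ?p) = ?q \<otimes> c \<otimes> ?p"
    using Cons.prems closed c one_minus_commute[of c f] by (simp flip: m_assoc)
  also have "\<dots> = ?q \<otimes> ?p \<otimes> c"
    using Cons closed c by (simp add: m_assoc)
  finally show ?case
    by (simp add: prod_one_minus_def)
qed

text \<open>\<open>f\<close> is moved past the factors that precede its own; there
  \<open>f (1 - f) = 0\<close> by idempotency. The second equation follows because \<open>f\<close>
  commutes with the whole product.\<close>

lemma (in ring) prod_one_minus_annihilates: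
  assumes fs: "set fs \<subseteq> carrier R" and f: "f \<in> set fs"
    and comm: "\<And>f g. f \<in> set fs \<Longrightarrow> g \<in> set fs \<Longrightarrow> f \<otimes> g = g \<otimes> f"
    and idem: "\<And>f. f \<in> set fs \<Longrightarrow> f \<otimes> f = f"
  shows "f \<otimes> prod_one_minus fs = \<zero>" and "prod_one_minus fs \<otimes> f = \<zero>"
proof -
  show left: "f \<otimes> prod_one_minus fs = \<zero>"
    using assms
  proof (induction fs)
    case (Cons g fs)
    let ?p = "prod_one_minus fs"
    have closed: "?p \<in> carrier R" "\<one> \<ominus> g \<in> carrier R" "f \<in> carrier R" "g \<in> carrier R"
      using Cons.prems(1,2) by (auto simp: prod_one_minus_closed)
    have "f \<otimes> ((\<one> \<ominus> g) \<otimes> ?p) = \<zero>"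
    proof (cases "f = g")
      case True
      have "f \<otimes> (\<one> \<ominus> f) = \<zero>"
        using closed(3) Cons.prems(4)[OF Cons.prems(2)] by (simp add: minus_eq r_distr r_minus r_neg)
      then show ?thesis
        using True closed by (simp flip: m_assoc)
    next
      case False
      then have "f \<otimes> ?p = \<zero>"
        using Cons.prems by (intro Cons.IH) auto
      moreover have "f \<otimes> (\<one> \<ominus> g) = (\<one> \<ominus> g) \<otimes> f"
        using Cons.prems(2) by (intro one_minus_commute closed Cons.prems(3)) auto
      moreover have "f \<otimes> ((\<one> \<ominus> g) \<otimes> ?p) = (f \<otimes> (\<one> \<ominus> g)) \<otimes> ?p"
        using closed by (simp add: m_assoc)
      ultimately show ?thesis
        using closed by (simp add: m_assoc)
    qed
    then show ?case
      by (simp add: prod_one_minus_def)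
  qed simp
  have "f \<otimes> prod_one_minus fs = prod_one_minus fs \<otimes> f"
    using f fs comm by (intro prod_one_minus_commute) auto
  then show "prod_one_minus fs \<otimes> f = \<zero>"
    using left by simp
qed

text \<open>Every factor is sent to \<open>1 - 0\<close>.\<close>

lemma (in ring_hom_ring) hom_prod_one_minus:
  assumes "set fs \<subseteq> carrier R" and "\<And>f. f \<in> set fs \<Longrightarrow> h f = \<zero>\<^bsub>S\<^esub>"
  shows "h (R.prod_one_minus fs) = \<one>\<^bsub>S\<^esub>"
  using assms
proof (induction fs)
  case (Cons f fs)
  then have "R.prod_one_minus fs \<in> carrier R" "f \<in> carrier R"
    by (simp_all add: R.prod_one_minus_closed)
  moreover have "R.prod_one_minus (f # fs) = (\<one> \<ominus> f) \<otimes> R.prod_one_minus fs"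
    by (simp add: R.prod_one_minus_def)
  ultimately show ?case
    using Cons by (simp add: R.minus_eq S.minus_eq)
qed (simp add: R.prod_one_minus_def)

text \<open>Both \<open>r (1 - e)\<close> and \<open>(1 - e) r\<close> lie in \<open>I\<close>, so
  \<open>e r = e r e = r e\<close>.\<close>

lemma (in ring) central_if_annihilates_ideal:
  assumes e: "e \<in> carrier R" and I: "ideal I R" "\<one> \<ominus> e \<in> I"
    and ann: "\<And>x. x \<in> I \<Longrightarrow> e \<otimes> x = \<zero>" "\<And>x. x \<in> I \<Longrightarrow> x \<otimes> e = \<zero>"
    and r: "r \<in> carrier R"
  shows "e \<otimes> r = r \<otimes> e"
proof -
  have "e \<otimes> (r \<otimes> (\<one> \<ominus> e)) = \<zero>" "((\<one> \<ominus> e) \<otimes> r) \<otimes> e = \<zero>"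
    using ideal.I_l_closed[OF I(1,2) r] ideal.I_r_closed[OF I(1,2) r] by (simp_all add: ann)
  then have "e \<otimes> r \<ominus> e \<otimes> r \<otimes> e = \<zero>" "r \<otimes> e \<ominus> e \<otimes> r \<otimes> e = \<zero>"
    using e r by (simp_all add: minus_eq r_distr l_distr r_minus l_minus m_assoc)
  then show ?thesis
    using e r by (simp add: r_right_minus_eq)
qed

section \<open>Matrices with at most one nonzero entry per row and column\<close>

text \<open>Row \<open>i\<close> of \<open>A\<close> has at most one nonzero entry, so at most one
  summand survives. This relational form replaces the fold in the definition of
  \<open>zmat_mult\<close>.\<close>

lemma zmat_mult_eq_Some_iff:
  assumes "A \<in> carrier (partial_monomial G n)"
  shows "zmat_mult G n A B i j = Some c \<longleftrightarrow>
    (\<exists>k a b. A i k = Some a \<and> B k j = Some b \<and> c = a \<otimes>\<^bsub>G\<^esub> b)"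
proof
  assume *: "zmat_mult G n A B i j = Some c"
  then obtain k where "A i k \<noteq> None" "B k j \<noteq> None"
    using zmat_mult_nonzeroD[of G n A B i j] by auto
  then obtain a b where ab: "A i k = Some a" "B k j = Some b"
    by auto
  then show "\<exists>k a b. A i k = Some a \<and> B k j = Some b \<and> c = a \<otimes>\<^bsub>G\<^esub> b"
    using zmat_mult_Some[OF assms ab(1), of B j b] * by auto
qed (auto simp: zmat_mult_Some[OF assms])

text \<open>Matrices are compared through their nonzero entries only, so that the relational
  description of products can be used on both sides.\<close>

lemma option_eq_if_Some_iff: "(\<And>c. x = Some c \<longleftrightarrow> y = Some c) \<Longrightarrow> x = y"
  by (cases x; cases y) auto

text \<open>A product composes the relations of nonzero positions and multiplies the entries along a
  path. Both bracketings describe the paths from \<open>i\<close> through \<open>k\<close> and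
  \<open>l\<close> to \<open>j\<close>; only the product of three group elements is
  rebracketed.\<close>

lemma zmat_mult_assoc:
  assumes G: "group G" and A: "A \<in> carrier (partial_monomial G n)"
    and B: "B \<in> carrier (partial_monomial G n)" and C: "C \<in> carrier (partial_monomial G n)"
  shows "zmat_mult G n (zmat_mult G n A B) C = zmat_mult G n A (zmat_mult G n B C)"
proof (intro ext option_eq_if_Some_iff)
  fix i j d
  have carr: "a \<in> carrier G" if "D i k = Some a" "D \<in> carrier (partial_monomial G n)" for D i k a
    using partial_monomialD(1)[OF that(2)] that(1) by (auto simp: zmats_def)
  have assoc: "a \<otimes>\<^bsub>G\<^esub> b \<otimes>\<^bsub>G\<^esub> c = a \<otimes>\<^bsub>G\<^esub> (b \<otimes>\<^bsub>G\<^esub> c)"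
    if "A i k = Some a" "B k l = Some b" "C l j = Some c" for k l a b c
    using monoid.m_assoc[OF group.is_monoid[OF G]] carr that A B C by metis
  have "zmat_mult G n (zmat_mult G n A B) C i j = Some d \<longleftrightarrow>
      (\<exists>k l a b c. A i k = Some a \<and> B k l = Some b \<and> C l j = Some c \<and> d = a \<otimes>\<^bsub>G\<^esub> b \<otimes>\<^bsub>G\<^esub> c)"
    unfolding zmat_mult_eq_Some_iff[OF partial_monomial_mult_closed[OF G A B]] zmat_mult_eq_Some_iff[OF A]
    by blast
  also have "\<dots> \<longleftrightarrow>
      (\<exists>k l a b c. A i k = Some a \<and> B k l = Some b \<and> C l j = Some c \<and> d = a \<otimes>\<^bsub>G\<^esub> (b \<otimes>\<^bsub>G\<^esub> c))"
    using assoc by metis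
  also have "\<dots> \<longleftrightarrow> zmat_mult G n A (zmat_mult G n B C) i j = Some d"
    unfolding zmat_mult_eq_Some_iff[OF A] zmat_mult_eq_Some_iff[OF B] by blast
  finally show "zmat_mult G n (zmat_mult G n A B) C i j = Some d \<longleftrightarrow>
      zmat_mult G n A (zmat_mult G n B C) i j = Some d" .
qed

section \<open>Deletion of rows and columns, and the monoid structure\<close>

lemma zmat_eps_closed:
  assumes "group G"
  shows "zmat_eps G n j \<in> carrier (partial_monomial G n)"
  using group.is_monoid[OF assms]
  by (auto simp: partial_monomial_def zmats_def zmat_eps_def Uniq_def monoid.one_closed split: if_splits)

lemma zmat_one_closed:
  assumes "group G"
  shows "zmat_one G n \<in> carrier (monomial_group G n)"
  using group.is_monoid[OF assms]
  by (auto simp: monomial_group_def zmats_def zmat_one_def monoid.one_closed)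

text \<open>
  The index \<open>0\<close> lies outside of \<open>{1..n}\<close>; this makes the unit laws instances of the multiplication
  rules for \<open>\<epsilon>\<^sub>j\<close>.
\<close>

lemma zmat_eps_0: "zmat_eps G n 0 = zmat_one G n"
  by (auto simp: zmat_eps_def zmat_one_def fun_eq_iff)

text \<open>Row \<open>i\<close> of \<open>zmat_eps G n j\<close> has at most one nonzero entry, a 1
  on the diagonal, and is empty if \<open>i = j\<close>.\<close>

lemma zmat_eps_mult:
  assumes "group G" and A: "A \<in> carrier (partial_monomial G n)"
  shows "zmat_mult G n (zmat_eps G n j) A = (\<lambda>i k. if i = j then None else A i k)"
proof (intro ext option_eq_if_Some_iff)
  fix i k c
  have "a \<in> carrier G" "i \<in> {1..n}" if "A i k = Some a" for a
    using partial_monomialD(1)[OF A] that by (auto simp: zmats_def)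
  then show "zmat_mult G n (zmat_eps G n j) A i k = Some c \<longleftrightarrow> (if i = j then None else A i k) = Some c"
    unfolding zmat_mult_eq_Some_iff[OF zmat_eps_closed[OF assms(1)]]
    using monoid.l_one[OF group.is_monoid[OF assms(1)]] by (auto simp: zmat_eps_def)
qed

lemma mult_zmat_eps:
  assumes "group G" and A: "A \<in> carrier (partial_monomial G n)"
  shows "zmat_mult G n A (zmat_eps G n j) = (\<lambda>i k. if k = j then None else A i k)"
proof (intro ext option_eq_if_Some_iff)
  fix i k c
  have "a \<in> carrier G" "k \<in> {1..n}" if "A i k = Some a" for a
    using partial_monomialD(1)[OF A] that by (auto simp: zmats_def)
  then show "zmat_mult G n A (zmat_eps G n j) i k = Some c \<longleftrightarrow> (if k = j then None else A i k) = Some c"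
    unfolding zmat_mult_eq_Some_iff[OF A]
    using monoid.r_one[OF group.is_monoid[OF assms(1)]] by (auto simp: zmat_eps_def)
qed

lemma monoid_partial_monomial:
  assumes "group G"
  shows "monoid (partial_monomial G n)"
proof (rule monoidI)
  have ops: "A \<otimes>\<^bsub>partial_monomial G n\<^esub> B = zmat_mult G n A B" "\<one>\<^bsub>partial_monomial G n\<^esub> = zmat_one G n" for A B
    by (simp_all add: partial_monomial_def)
  show "\<one>\<^bsub>partial_monomial G n\<^esub> \<in> carrier (partial_monomial G n)"
    using zmat_one_closed[OF assms] by (simp add: ops monomial_group_iff)
  fix A B C
  assume A: "A \<in> carrier (partial_monomial G n)"
  \<comment> \<open>Row and column 0 are empty already, so clearing them, as
    \<open>zmat_eps G n 0\<close> does, leaves \<open>A\<close> unchanged.\<close>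
  have zero: "A i k = None" if "i = 0 \<or> k = 0" for i k
    using zmats_index[OF partial_monomialD(1)[OF A], of i k] that by (cases "A i k") auto
  show "\<one>\<^bsub>partial_monomial G n\<^esub> \<otimes>\<^bsub>partial_monomial G n\<^esub> A = A"
    using zmat_eps_mult[OF assms A, of 0] by (auto simp: ops zmat_eps_0 zero fun_eq_iff)
  show "A \<otimes>\<^bsub>partial_monomial G n\<^esub> \<one>\<^bsub>partial_monomial G n\<^esub> = A"
    using mult_zmat_eps[OF assms A, of 0] by (auto simp: ops zmat_eps_0 zero fun_eq_iff)
  assume B: "B \<in> carrier (partial_monomial G n)"
  show "A \<otimes>\<^bsub>partial_monomial G n\<^esub> B \<in> carrier (partial_monomial G n)"
    using partial_monomial_mult_closed[OF assms A B] by (simp add: ops)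
  assume C: "C \<in> carrier (partial_monomial G n)"
  show "A \<otimes>\<^bsub>partial_monomial G n\<^esub> B \<otimes>\<^bsub>partial_monomial G n\<^esub> C =
      A \<otimes>\<^bsub>partial_monomial G n\<^esub> (B \<otimes>\<^bsub>partial_monomial G n\<^esub> C)"
    using zmat_mult_assoc[OF assms A B C] by (simp add: ops)
qed

text \<open>The two records share product and unit and differ only in the carrier, so the monoid
  axioms are inherited from \<open>partial_monomial G n\<close> by a submonoid.\<close>

lemma monoid_monomial_group:
  assumes "group G"
  shows "monoid (monomial_group G n)"
proof -
  interpret monoid "partial_monomial G n"
    by (rule monoid_partial_monomial[OF assms])
  have "submonoid (carrier (monomial_group G n)) (partial_monomial G n)"
    using zmat_one_closed[OF assms] monomial_group_mult_closed[OF assms]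
    by unfold_locales (auto simp: monomial_group_iff, simp_all add: partial_monomial_def)
  from submonoid.submonoid_is_monoid[OF this monoid_axioms]
  show ?thesis
    by (simp add: partial_monomial_def monomial_group_def)
qed

text \<open>The nonzero positions form a partial injection of the finite set \<open>{1..n}\<close>
  into itself, which is total if and only if it is onto. Hence zero rows and zero columns occur
  together.\<close>

lemma singular_zero_row_column:
  assumes A: "A \<in> carrier (partial_monomial G n)" and sing: "A \<notin> carrier (monomial_group G n)"
  obtains i j where "i \<in> {1..n}" "j \<in> {1..n}" "\<And>k. A i k = None" "\<And>k. A k j = None"
proof -
  let ?row = "\<forall>i\<in>{1..n}. \<exists>j\<in>{1..n}. A i j \<noteq> None" and ?col = "\<forall>j\<in>{1..n}. \<exists>i\<in>{1..n}. A i j \<noteq> None"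
  have "?row \<Longrightarrow> ?col"
    using inj_total_relation_surj[of n "\<lambda>i j. A i j \<noteq> None"] partial_monomialD(3)[OF A] by blast
  moreover have "?col \<Longrightarrow> ?row"
    using inj_total_relation_surj[of n "\<lambda>j i. A i j \<noteq> None"] partial_monomialD(2)[OF A] by blast
  ultimately have "\<not> ?row" "\<not> ?col"
    using A sing unfolding monomial_group_iff by blast+
  then obtain i j where "i \<in> {1..n}" "j \<in> {1..n}"
    "\<And>k. k \<in> {1..n} \<Longrightarrow> A i k = None" "\<And>k. k \<in> {1..n} \<Longrightarrow> A k j = None"
    by blast
  then show thesis
    using zmats_index[OF partial_monomialD(1)[OF A]] that by metis
qed

section \<open>The central idempotent annihilating the singular matrices\<close>

lemma monomial_subset_partial_monomial:
  "carrier (monomial_group G n) \<subseteq> carrier (partial_monomial G n)"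
  by (auto simp: monomial_group_iff)

text \<open>An inclusion of sets, because algebra elements are functions extended by zero; no
  embedding has to be carried along.\<close>

lemma monomial_algebra_subset:
  "carrier (semigroup_algebra F (monomial_group G n)) \<subseteq> carrier (semigroup_algebra F (partial_monomial G n))"
  using monomial_subset_partial_monomial[of G n] by (auto simp: semigroup_algebra_def)

lemma monoid_algebra_partial_monomial:
  assumes "field F" and "group G"
  shows "monoid_algebra F (partial_monomial G n)"
  using assms by (intro monoid_algebra.intro monoid_partial_monomial field.is_ring)

lemma monoid_algebra_monomial_group:
  assumes "field F" and "group G"
  shows "monoid_algebra F (monomial_group G n)"
  using assms by (intro monoid_algebra.intro monoid_monomial_group field.is_ring)

text \<open>The element \<open>e\<close> is built without reference to \<Phi>. The span of the
  singular matrices is realised as the kernel of \<open>restrict_algebra\<close>, which supplies the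
  ideal property at once and whose elements have explicit supports.\<close>

lemma central_singular_annihilator:
  fixes F :: "('f, 'x) ring_scheme" and G :: "('g, 'y) monoid_scheme" and n :: nat
  assumes F: "field F" and G: "group G"
  defines "FM \<equiv> semigroup_algebra F (partial_monomial G n)"
    and "FH \<equiv> semigroup_algebra F (monomial_group G n)"
  assumes \<Phi>: "\<Phi> \<in> ring_hom FM FH"
    "\<And>j. j \<in> {1..n} \<Longrightarrow> \<Phi> (basis_elt F (zmat_eps G n j)) = \<zero>\<^bsub>FH\<^esub>"
  obtains e where "e \<in> carrier FM"
    and "\<And>a. a \<in> carrier FM \<Longrightarrow> e \<otimes>\<^bsub>FM\<^esub> a = a \<otimes>\<^bsub>FM\<^esub> e"
    and "\<And>A. A \<in> carrier (partial_monomial G n) \<Longrightarrow> A \<notin> carrier (monomial_group G n) \<Longrightarrow>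
           e \<otimes>\<^bsub>FM\<^esub> basis_elt F A = \<zero>\<^bsub>FM\<^esub>"
    and "\<Phi> e = \<one>\<^bsub>FH\<^esub>"
proof -
  let ?M = "partial_monomial G n" and ?H = "monomial_group G n"
  let ?eps = "\<lambda>j. basis_elt F (zmat_eps G n j)"
  interpret M: monoid_algebra F ?M
    by (rule monoid_algebra_partial_monomial[OF F G])
  interpret H: monoid_algebra F ?H
    by (rule monoid_algebra_monomial_group[OF F G])
  interpret FM: ring FM
    unfolding FM_def by (rule M.ring_algebra)
  interpret FH: ring FH
    unfolding FH_def by (rule H.ring_algebra)
  have mult_M: "A \<otimes>\<^bsub>?M\<^esub> B = zmat_mult G n A B" for A B
    by (simp add: partial_monomial_def)
  have basis_closed: "basis_elt F A \<in> carrier FM" if "A \<in> carrier ?M" for A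
    unfolding FM_def by (rule M.basis_elt_closed[OF that])
  have basis_mult: "basis_elt F A \<otimes>\<^bsub>FM\<^esub> basis_elt F B = basis_elt F (zmat_mult G n A B)"
    if "A \<in> carrier ?M" "B \<in> carrier ?M" for A B
    unfolding FM_def using M.basis_elt_mult_basis_elt[OF that] by (simp add: mult_M)
  note eps_M = zmat_eps_closed[OF G, of n]
  have eps_comm: "?eps i \<otimes>\<^bsub>FM\<^esub> ?eps j = ?eps j \<otimes>\<^bsub>FM\<^esub> ?eps i" for i j
  proof -
    have "zmat_mult G n (zmat_eps G n i) (zmat_eps G n j) = zmat_mult G n (zmat_eps G n j) (zmat_eps G n i)"
      unfolding zmat_eps_mult[OF G eps_M] by (auto simp: zmat_eps_def fun_eq_iff)
    then show ?thesis
      by (simp add: basis_mult eps_M)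
  qed
  have eps_idem: "?eps j \<otimes>\<^bsub>FM\<^esub> ?eps j = ?eps j" for j
  proof -
    have "zmat_mult G n (zmat_eps G n j) (zmat_eps G n j) = zmat_eps G n j"
      unfolding zmat_eps_mult[OF G eps_M] by (auto simp: zmat_eps_def fun_eq_iff)
    then show ?thesis
      by (simp add: basis_mult eps_M)
  qed
  \<comment> \<open>The upper end is exclusive, so the list runs through the indices from 1 to
    \<open>n\<close>.\<close>
  define fs where "fs = map ?eps [1..<Suc n]"
  have set_fs: "set fs = ?eps ` {1..n}"
    by (simp add: fs_def atLeastLessThanSuc_atLeastAtMost del: upt_Suc)
  then have fs_closed: "set fs \<subseteq> carrier FM"
    using basis_closed eps_M by auto
  define e where "e = FM.prod_one_minus fs"
  have e: "e \<in> carrier FM"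
    unfolding e_def by (rule FM.prod_one_minus_closed[OF fs_closed])
  have fs_comm: "f \<otimes>\<^bsub>FM\<^esub> g = g \<otimes>\<^bsub>FM\<^esub> f" if "f \<in> set fs" "g \<in> set fs" for f g
    using that eps_comm unfolding set_fs by blast
  have fs_idem: "f \<otimes>\<^bsub>FM\<^esub> f = f" if "f \<in> set fs" for f
    using that eps_idem unfolding set_fs by blast
  have "?eps j \<otimes>\<^bsub>FM\<^esub> e = \<zero>\<^bsub>FM\<^esub>" "e \<otimes>\<^bsub>FM\<^esub> ?eps j = \<zero>\<^bsub>FM\<^esub>" if "j \<in> {1..n}" for j
    unfolding e_def
    using FM.prod_one_minus_annihilates[OF fs_closed _ fs_comm fs_idem, of "?eps j"] that
    unfolding set_fs by blast+
  note eps_ann = this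
  have ann: "e \<otimes>\<^bsub>FM\<^esub> basis_elt F A = \<zero>\<^bsub>FM\<^esub>" "basis_elt F A \<otimes>\<^bsub>FM\<^esub> e = \<zero>\<^bsub>FM\<^esub>"
    if A: "A \<in> carrier ?M" "A \<notin> carrier ?H" for A
  proof -
    obtain i j where ij: "i \<in> {1..n}" "j \<in> {1..n}" "\<And>k. A i k = None" "\<And>k. A k j = None"
      using singular_zero_row_column[OF A] by metis
    \<comment> \<open>Row \<open>i\<close> and column \<open>j\<close> of \<open>A\<close> are zero
      already, so clearing them changes nothing.\<close>
    have "zmat_mult G n (zmat_eps G n i) A = A" "zmat_mult G n A (zmat_eps G n j) = A"
      unfolding zmat_eps_mult[OF G A(1)] mult_zmat_eps[OF G A(1)] by (auto simp: ij fun_eq_iff)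
    then have "basis_elt F A = ?eps i \<otimes>\<^bsub>FM\<^esub> basis_elt F A" "basis_elt F A = basis_elt F A \<otimes>\<^bsub>FM\<^esub> ?eps j"
      by (simp_all add: basis_mult eps_M A)
    note eq = this
    \<comment> \<open>Reassociated, the product begins with \<open>e\<close> times the idempotent of
      the zero row, which vanishes.\<close>
    have "e \<otimes>\<^bsub>FM\<^esub> (?eps i \<otimes>\<^bsub>FM\<^esub> basis_elt F A) = \<zero>\<^bsub>FM\<^esub>"
      using e basis_closed A(1) eps_M eps_ann(2)[OF ij(1)] by (simp flip: FM.m_assoc)
    then show "e \<otimes>\<^bsub>FM\<^esub> basis_elt F A = \<zero>\<^bsub>FM\<^esub>"
      unfolding eq(1)[symmetric] .
    have "(basis_elt F A \<otimes>\<^bsub>FM\<^esub> ?eps j) \<otimes>\<^bsub>FM\<^esub> e = \<zero>\<^bsub>FM\<^esub>"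
      using e basis_closed A(1) eps_M eps_ann(1)[OF ij(2)] by (simp add: FM.m_assoc)
    then show "basis_elt F A \<otimes>\<^bsub>FM\<^esub> e = \<zero>\<^bsub>FM\<^esub>"
      unfolding eq(2)[symmetric] .
  qed
  \<comment> \<open>The homomorphism \<open>h\<close> is arbitrary because the fact is used twice:
    for the restriction, to place \<open>1 - e\<close> in its kernel, and for \<Phi>.\<close>
  have hom_e: "h e = \<one>\<^bsub>FH\<^esub>"
    if "h \<in> ring_hom FM FH" "\<And>j. j \<in> {1..n} \<Longrightarrow> h (?eps j) = \<zero>\<^bsub>FH\<^esub>" for h
  proof -
    interpret ring_hom_ring FM FH h
      by (rule ring_hom_ringI2[OF FM.ring_axioms FH.ring_axioms that(1)])
    show ?thesis
      unfolding e_def using that(2) by (intro hom_prod_one_minus[OF fs_closed]) (auto simp: set_fs)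
  qed
  let ?r = "restrict_algebra F G n"
  interpret r: ring_hom_ring FM FH ?r
    using restrict_algebra_hom(1)[OF F G, of n]
    by (intro ring_hom_ringI2 FM.ring_axioms FH.ring_axioms) (simp add: algebra_hom_def FM_def FH_def)
  let ?I = "a_kernel FM FH ?r"
  have r_e: "?r e = \<one>\<^bsub>FH\<^esub>"
    using hom_e[OF r.homh] restrict_algebra_hom(3)[OF F G] unfolding FH_def by blast
  have "?r (\<one>\<^bsub>FM\<^esub> \<ominus>\<^bsub>FM\<^esub> e) = \<one>\<^bsub>FH\<^esub> \<oplus>\<^bsub>FH\<^esub> \<ominus>\<^bsub>FH\<^esub> ?r e"
    unfolding FM.minus_eq r.hom_add[OF FM.one_closed FM.a_inv_closed[OF e]]
      r.hom_a_inv[OF e] r.hom_one ..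
  also have "\<dots> = \<zero>\<^bsub>FH\<^esub>"
    unfolding r_e by (rule FH.r_neg[OF FH.one_closed])
  finally have one_e: "\<one>\<^bsub>FM\<^esub> \<ominus>\<^bsub>FM\<^esub> e \<in> ?I"
    unfolding a_kernel_def' using FM.minus_closed[OF FM.one_closed e] by blast
  \<comment> \<open>An element killed by restriction has no invertible matrix in its
    support.\<close>
  have ker: "a \<in> carrier FM" "s \<in> carrier ?M" "s \<notin> carrier ?H"
    if "a \<in> ?I" "s \<in> supp F a" for a s
  proof -
    have a: "a \<in> carrier FM" "?r a = \<zero>\<^bsub>FH\<^esub>"
      using that(1) unfolding a_kernel_def' by blast+
    show "a \<in> carrier FM"
      by (rule a(1))
    show "s \<in> carrier ?M"
      using subsetD[OF M.algebra_carrierD(3)[OF a(1)[unfolded FM_def]] that(2)] .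
    have "?r a s = \<zero>\<^bsub>F\<^esub>"
      unfolding a(2) FH_def by (rule H.zero_eq)
    then show "s \<notin> carrier ?H"
      using that(2) unfolding restrict_algebra_def supp_def by auto
  qed
  \<comment> \<open>Annihilation of single matrices extends to the kernel by testing it on
    supports.\<close>
  have ker_ann: "e \<otimes>\<^bsub>FM\<^esub> a = \<zero>\<^bsub>FM\<^esub>" "a \<otimes>\<^bsub>FM\<^esub> e = \<zero>\<^bsub>FM\<^esub>" if "a \<in> ?I" for a
  proof -
    have a: "a \<in> carrier FM"
      using that unfolding a_kernel_def' by blast
    show "e \<otimes>\<^bsub>FM\<^esub> a = \<zero>\<^bsub>FM\<^esub>"
      using M.mult_eq_zero_right[OF a[unfolded FM_def] e[unfolded FM_def]] ann(1) ker(2,3)[OF that]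
      unfolding FM_def by metis
    show "a \<otimes>\<^bsub>FM\<^esub> e = \<zero>\<^bsub>FM\<^esub>"
      using M.mult_eq_zero_left[OF a[unfolded FM_def] e[unfolded FM_def]] ann(2) ker(2,3)[OF that]
      unfolding FM_def by metis
  qed
  show thesis
  proof (rule that)
    show "e \<otimes>\<^bsub>FM\<^esub> a = a \<otimes>\<^bsub>FM\<^esub> e" if "a \<in> carrier FM" for a
      by (rule FM.central_if_annihilates_ideal[OF e r.kernel_is_ideal one_e ker_ann that])
    show "e \<otimes>\<^bsub>FM\<^esub> basis_elt F A = \<zero>\<^bsub>FM\<^esub>" if "A \<in> carrier ?M" "A \<notin> carrier ?H" for A
      using ann(1)[OF that] .
    show "\<Phi> e = \<one>\<^bsub>FH\<^esub>"
      by (rule hom_e[OF \<Phi>])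
  qed (rule e)
qed

section \<open>The image of the centralizer under \<Phi>\<close>

theorem lemma2p6:
  fixes F :: "('f, 'x) ring_scheme"
    and G :: "('g, 'y) monoid_scheme"
    and m n :: nat
    and \<Phi> :: "('g zmat \<Rightarrow> 'f) \<Rightarrow> ('g zmat \<Rightarrow> 'f)"
  assumes "field F"
    and "group G" and "finite (carrier G)"
    and "m \<le> n" and "n \<ge> 1"
    and "\<Phi> \<in> algebra_hom F (semigroup_algebra F (partial_monomial G n))
                          (semigroup_algebra F (monomial_group G n))"
    and "\<And>a. a \<in> carrier (semigroup_algebra F (monomial_group G n)) \<Longrightarrow> \<Phi> a = a"
    and "\<And>j. j \<in> {1..n} \<Longrightarrow>
           \<Phi> (basis_elt F (zmat_eps G n j)) = \<zero>\<^bsub>semigroup_algebra F (monomial_group G n)\<^esub>"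
  shows "\<Phi> ` partial_monomial_centralizer F G m n = monomial_centralizer F G m n"
proof -
  let ?M = "partial_monomial G n" and ?H = "monomial_group G n"
  let ?FM = "semigroup_algebra F ?M" and ?FH = "semigroup_algebra F ?H"
  interpret M: monoid_algebra F ?M
    by (rule monoid_algebra_partial_monomial[OF assms(1,2)])
  interpret H: monoid_algebra F ?H
    by (rule monoid_algebra_monomial_group[OF assms(1,2)])
  interpret FM: ring ?FM
    by (rule M.ring_algebra)
  interpret FH: ring ?FH
    by (rule H.ring_algebra)
  have hom: "\<Phi> \<in> ring_hom ?FM ?FH"
    using assms(6) by (simp add: algebra_hom_def)
  interpret \<Phi>: ring_hom_ring ?FM ?FH \<Phi>
    by (rule ring_hom_ringI2[OF FM.ring_axioms FH.ring_axioms hom])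
  have sub: "a \<in> carrier ?FM" if "a \<in> carrier ?FH" for a
    using that monomial_algebra_subset by blast
  \<comment> \<open>Both algebras use the same formula for the product, as the two semigroups share
    \<open>zmat_mult\<close>. Commutation in the group algebra can thus be read in the larger
    algebra.\<close>
  have mult_FH: "a \<otimes>\<^bsub>?FH\<^esub> b = a \<otimes>\<^bsub>?FM\<^esub> b" for a b
    by (simp add: semigroup_algebra_def partial_monomial_def monomial_group_def)
  have basis_FH: "basis_elt F x \<in> carrier ?FH" if "x \<in> monomial_group_sub G m n" for x
    using that by (intro H.basis_elt_closed) (simp add: monomial_group_sub_def)
  show ?thesis
  proof (intro equalityI subsetI)
    fix b assume "b \<in> \<Phi> ` partial_monomial_centralizer F G m n"
    then obtain a where a: "a \<in> carrier ?FM" "b = \<Phi> a"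
      and comm: "\<And>x. x \<in> partial_monomial_sub G m n \<Longrightarrow>
        a \<otimes>\<^bsub>?FM\<^esub> basis_elt F x = basis_elt F x \<otimes>\<^bsub>?FM\<^esub> a"
      by (auto simp: partial_monomial_centralizer_def centralizer_def)
    have "b \<otimes>\<^bsub>?FH\<^esub> basis_elt F x = basis_elt F x \<otimes>\<^bsub>?FH\<^esub> b" if x: "x \<in> monomial_group_sub G m n" for x
    proof -
      note bx = basis_FH[OF x]
      \<comment> \<open>\<Phi> is applied to the commutation relation; it fixes
        \<open>basis_elt F x\<close> because \<open>x\<close> is invertible.\<close>
      have "\<Phi> (a \<otimes>\<^bsub>?FM\<^esub> basis_elt F x) = \<Phi> (basis_elt F x \<otimes>\<^bsub>?FM\<^esub> a)"
        using x comm by (simp add: monomial_group_sub_def)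
      then show ?thesis
        using a sub[OF bx] assms(7)[OF bx] by simp
    qed
    then show "b \<in> monomial_centralizer F G m n"
      using a by (auto simp: monomial_centralizer_def centralizer_def)
  next
    fix a assume "a \<in> monomial_centralizer F G m n"
    then have a: "a \<in> carrier ?FH"
      and comm: "\<And>x. x \<in> monomial_group_sub G m n \<Longrightarrow>
        a \<otimes>\<^bsub>?FM\<^esub> basis_elt F x = basis_elt F x \<otimes>\<^bsub>?FM\<^esub> a"
      by (auto simp: monomial_centralizer_def centralizer_def mult_FH)
    obtain e where e: "e \<in> carrier ?FM"
      and central: "\<And>a. a \<in> carrier ?FM \<Longrightarrow> e \<otimes>\<^bsub>?FM\<^esub> a = a \<otimes>\<^bsub>?FM\<^esub> e"
      and ann: "\<And>A. A \<in> carrier ?M \<Longrightarrow> A \<notin> carrier ?H \<Longrightarrow> e \<otimes>\<^bsub>?FM\<^esub> basis_elt F A = \<zero>\<^bsub>?FM\<^esub>"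
      and hom_e: "\<Phi> e = \<one>\<^bsub>?FH\<^esub>"
      using central_singular_annihilator[OF assms(1,2) hom assms(8)] by blast
    \<comment> \<open>The preimage of \<open>a\<close> will be \<open>a e\<close>; its commutation
      with \<open>x\<close> is checked separately for invertible and for singular
      \<open>x\<close>.\<close>
    have "(a \<otimes>\<^bsub>?FM\<^esub> e) \<otimes>\<^bsub>?FM\<^esub> basis_elt F x = basis_elt F x \<otimes>\<^bsub>?FM\<^esub> (a \<otimes>\<^bsub>?FM\<^esub> e)"
      if x: "x \<in> partial_monomial_sub G m n" for x
    proof -
      have xM: "x \<in> carrier ?M"
        using x by (simp add: partial_monomial_sub_def)
      note bx = M.basis_elt_closed[OF xM]
      have left: "(a \<otimes>\<^bsub>?FM\<^esub> e) \<otimes>\<^bsub>?FM\<^esub> basis_elt F x = a \<otimes>\<^bsub>?FM\<^esub> (e \<otimes>\<^bsub>?FM\<^esub> basis_elt F x)"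
        using a e bx sub by (intro FM.m_assoc) auto
      \<comment> \<open>Centrality enters twice:
        \<open>x (a e) = x (e a) = (x e) a = (e x) a\<close>. In this form a singular
        \<open>x\<close> meets \<open>e\<close> directly.\<close>
      have right: "basis_elt F x \<otimes>\<^bsub>?FM\<^esub> (a \<otimes>\<^bsub>?FM\<^esub> e) = (e \<otimes>\<^bsub>?FM\<^esub> basis_elt F x) \<otimes>\<^bsub>?FM\<^esub> a"
        using sub[OF a] e bx central[OF sub[OF a]] central[OF bx] by (metis FM.m_assoc)
      show ?thesis
      proof (cases "x \<in> carrier ?H")
        case True
        then have "a \<otimes>\<^bsub>?FM\<^esub> basis_elt F x = basis_elt F x \<otimes>\<^bsub>?FM\<^esub> a"
          using x by (intro comm) (simp add: monomial_group_sub_def)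
        \<comment> \<open>Here \<open>a\<close> commutes with \<open>x\<close> by assumption, and
          \<open>e\<close> commutes with \<open>x\<close> by centrality.\<close>
        then show ?thesis
          using sub[OF a] e bx central[OF bx] by (metis FM.m_assoc)
      next
        case False
        then show ?thesis
          unfolding left right ann[OF xM False] using sub[OF a] by simp
      qed
    qed
    then have "a \<otimes>\<^bsub>?FM\<^esub> e \<in> partial_monomial_centralizer F G m n"
      using sub[OF a] e by (auto simp: partial_monomial_centralizer_def centralizer_def)
    \<comment> \<open>\<Phi> is multiplicative, fixes \<open>a\<close> and sends \<open>e\<close> to
      1.\<close>
    moreover have "\<Phi> (a \<otimes>\<^bsub>?FM\<^esub> e) = a"
      using sub[OF a] a e hom_e assms(7)[OF a] by simp
    ultimately show "a \<in> \<Phi> ` partial_monomial_centralizer F G m n"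
      by (metis image_eqI)
  qed
qed

end
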